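(* Let $q$ be an odd prime power. In $\mathrm{PG}(3,q^2)$, let $\mathcal H$ be a non-degenerate Hermitian surface and $\mathcal Q$ an irreducible quadric such that there is a point $P\in\mathcal H\cap\mathcal Q$ which is a nonsingular point of $\mathcal Q$ and at which $\mathcal H$ and $\mathcal Q$ have the same tangent plane. Suppose $|\mathcal H\cap\mathcal Q|=2q^3+q^2+1$. Then $\mathcal Q$ is a hyperbolic quadric in permutable position with $\mathcal H$. In particular, there is a quadric $\mathcal Q'\subseteq\mathcal H\cap\mathcal Q$, contained in a subgeometry $\mathrm{PG}(3,q)$, such that all points of $\mathcal H\cap\mathcal Q$ lie on (extended) generators of $\mathcal Q'$.
   Context: $\mathcal Q$ and $\mathcal H$ are in permutable position if the polarities of $\mathrm{PG}(3,q^2)$ induced by $\mathcal Q$ and by $\mathcal H$ commute. A subgeometry $\mathrm{PG}(3,q)$ of $\mathrm{PG}(3,q^2)$ is a Baer subgeometry. A generator of a quadric is a line contained in it; an extended generator of $\mathcal Q'\subseteq\mathrm{PG}(3,q)$ is the line of $\mathrm{PG}(3,q^2)$ containing a generator of $\mathcal Q'$. *)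

theory Defs
  imports
    "HOL-Analysis.Analysis"
    "HOL-Library.Poly_Mapping"
    "HOL-Computational_Algebra.Factorial_Ring"
    "HOL-Number_Theory.Prime_Powers"
begin

text \<open>
  Subspaces of the projective space \<open>PG(3,F)\<close> are the linear subspaces of \<open>F\<^sup>4\<close>; incidence is
  inclusion. Quadrics, Hermitian surfaces and subgeometries are sets of points.
\<close>

definition pg_points :: "('a::field ^ 4) set set" where
  "pg_points = {U. vec.subspace U \<and> vec.dim U = 1}"

definition pg_lines :: "('a::field ^ 4) set set" where
  "pg_lines = {U. vec.subspace U \<and> vec.dim U = 2}"

definition points_on :: "('a::field ^ 4) set \<Rightarrow> ('a ^ 4) set set" where
  "points_on U = {P \<in> pg_points. P \<subseteq> U}"

subsection \<open>Quadrics\<close>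

text \<open>
  The characteristic is odd throughout, so a quadratic form is given by a symmetric matrix \<open>A\<close>,
  as \<open>x \<mapsto> \<Sum>i j. A\<^sub>i\<^sub>j x\<^sub>i x\<^sub>j\<close>.
\<close>

definition quad_bilin :: "'a::field ^ 4 ^ 4 \<Rightarrow> 'a ^ 4 \<Rightarrow> 'a ^ 4 \<Rightarrow> 'a" where
  "quad_bilin A x y = (\<Sum>i\<in>UNIV. \<Sum>j\<in>UNIV. A $ i $ j * x $ i * y $ j)"

definition quadric :: "'a::field ^ 4 ^ 4 \<Rightarrow> ('a ^ 4) set set" where
  "quadric A = {P \<in> pg_points. \<forall>x\<in>P. quad_bilin A x x = 0}"

text \<open>
  The type \<open>(4 \<Rightarrow>\<^sub>0 nat) \<Rightarrow>\<^sub>0 'a\<close>, with the convolution product, is the polynomial ring over \<open>'a\<close> in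
  four indeterminates: \<open>4 \<Rightarrow>\<^sub>0 nat\<close> is the monoid of exponent vectors.
\<close>

definition quad_poly :: "'a::field ^ 4 ^ 4 \<Rightarrow> (4 \<Rightarrow>\<^sub>0 nat) \<Rightarrow>\<^sub>0 'a" where
  "quad_poly A = (\<Sum>i\<in>UNIV. \<Sum>j\<in>UNIV.
     Poly_Mapping.single (Poly_Mapping.single i 1 + Poly_Mapping.single j 1) (A $ i $ j))"

definition irreducible_quadric :: "'a::field ^ 4 ^ 4 \<Rightarrow> bool" where
  "irreducible_quadric A \<longleftrightarrow> irreducible (quad_poly A)"

text \<open>The gradient of the quadratic form at \<open>x\<close> is \<open>2 A x\<close>.\<close>

definition nonsingular_point :: "'a::field ^ 4 ^ 4 \<Rightarrow> ('a ^ 4) set \<Rightarrow> bool" where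
  "nonsingular_point A P \<longleftrightarrow> P \<in> quadric A \<and> (\<exists>x\<in>P. A *v x \<noteq> 0)"

definition quad_polar :: "'a::field ^ 4 ^ 4 \<Rightarrow> ('a ^ 4) set \<Rightarrow> ('a ^ 4) set" where
  "quad_polar A U = {y. \<forall>x\<in>U. quad_bilin A x y = 0}"

definition quadric_tangent_plane :: "'a::field ^ 4 ^ 4 \<Rightarrow> ('a ^ 4) set \<Rightarrow> ('a ^ 4) set" where
  "quadric_tangent_plane A P = quad_polar A P"

text \<open>
  A hyperbolic quadric is a nonsingular quadric of projective index 1. Since a nonsingular quadric
  of \<open>PG(3,F)\<close> contains no plane, the index is 1 as soon as the quadric contains a line.
\<close>

definition hyperbolic_quadric :: "'a::field ^ 4 ^ 4 \<Rightarrow> bool" where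
  "hyperbolic_quadric A \<longleftrightarrow> transpose A = A \<and> det A \<noteq> 0 \<and>
     (\<exists>l\<in>pg_lines. points_on l \<subseteq> quadric A)"

subsection \<open>Hermitian surfaces\<close>

text \<open>Over the field of order \<open>q\<^sup>2\<close> the involutory automorphism is \<open>x \<mapsto> x ^ q\<close>.\<close>

definition hermitian_matrix :: "nat \<Rightarrow> 'a::field ^ 4 ^ 4 \<Rightarrow> bool" where
  "hermitian_matrix q H \<longleftrightarrow> (\<forall>i j. H $ j $ i = (H $ i $ j) ^ q)"

definition herm_form :: "nat \<Rightarrow> 'a::field ^ 4 ^ 4 \<Rightarrow> 'a ^ 4 \<Rightarrow> 'a ^ 4 \<Rightarrow> 'a" where
  "herm_form q H x y = (\<Sum>i\<in>UNIV. \<Sum>j\<in>UNIV. H $ i $ j * x $ i * (y $ j) ^ q)"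

definition hermitian_surface :: "nat \<Rightarrow> 'a::field ^ 4 ^ 4 \<Rightarrow> ('a ^ 4) set set" where
  "hermitian_surface q H = {P \<in> pg_points. \<forall>x\<in>P. herm_form q H x x = 0}"

definition herm_polar :: "nat \<Rightarrow> 'a::field ^ 4 ^ 4 \<Rightarrow> ('a ^ 4) set \<Rightarrow> ('a ^ 4) set" where
  "herm_polar q H U = {y. \<forall>x\<in>U. herm_form q H y x = 0}"

text \<open>
  As \<open>x ^ q\<close> has zero derivative, the gradient of \<open>herm_form q H x x\<close> has \<open>i\<close>-th component
  \<open>\<Sum>j. H\<^sub>i\<^sub>j x\<^sub>j ^ q\<close>, so the tangent plane is the polar plane.
\<close>

definition hermitian_tangent_plane :: "nat \<Rightarrow> 'a::field ^ 4 ^ 4 \<Rightarrow> ('a ^ 4) set \<Rightarrow> ('a ^ 4) set" where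
  "hermitian_tangent_plane q H P = herm_polar q H P"

definition permutable_position :: "nat \<Rightarrow> 'a::field ^ 4 ^ 4 \<Rightarrow> 'a ^ 4 ^ 4 \<Rightarrow> bool" where
  "permutable_position q H A \<longleftrightarrow>
     (\<forall>U. vec.subspace U \<longrightarrow> quad_polar A (herm_polar q H U) = herm_polar q H (quad_polar A U))"

subsection \<open>Baer subgeometries and their quadrics\<close>

text \<open>The subfield of order \<open>q\<close> of the field of order \<open>q\<^sup>2\<close> is \<open>{a. a ^ q = a}\<close>.\<close>

definition subfield_vecs :: "nat \<Rightarrow> ('a::field ^ 4) set" where
  "subfield_vecs q = {t. \<forall>i. (t $ i) ^ q = t $ i}"

text \<open>
  The columns of an invertible matrix \<open>M\<close> form the frame of the subgeometry, and \<open>t\<close> is the vector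
  of coordinates over the subfield.
\<close>

definition framed_subgeometry :: "nat \<Rightarrow> 'a::field ^ 4 ^ 4 \<Rightarrow> ('a ^ 4) set set" where
  "framed_subgeometry q M = {vec.span {M *v t} |t. t \<in> subfield_vecs q \<and> t \<noteq> 0}"

definition baer_subgeometry :: "nat \<Rightarrow> ('a::field ^ 4) set set \<Rightarrow> bool" where
  "baer_subgeometry q S \<longleftrightarrow> (\<exists>M. invertible M \<and> S = framed_subgeometry q M)"

definition baer_quadric :: "nat \<Rightarrow> ('a::field ^ 4) set set \<Rightarrow> ('a ^ 4) set set \<Rightarrow> bool" where
  "baer_quadric q S Q' \<longleftrightarrow> (\<exists>M B. invertible M \<and> S = framed_subgeometry q M \<and>
     transpose B = B \<and> B \<noteq> 0 \<and> (\<forall>i j. (B $ i $ j) ^ q = B $ i $ j) \<and>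
     Q' = {vec.span {M *v t} |t. t \<in> subfield_vecs q \<and> t \<noteq> 0 \<and> quad_bilin B t t = 0})"

definition baer_lines :: "('a::field ^ 4) set set \<Rightarrow> ('a ^ 4) set set set" where
  "baer_lines S = {points_on l \<inter> S |l. l \<in> pg_lines \<and> 2 \<le> card (points_on l \<inter> S)}"

definition baer_generators ::
    "('a::field ^ 4) set set \<Rightarrow> ('a ^ 4) set set \<Rightarrow> ('a ^ 4) set set set" where
  "baer_generators S Q' = {g \<in> baer_lines S. g \<subseteq> Q'}"

definition extended_generators ::
    "('a::field ^ 4) set set \<Rightarrow> ('a ^ 4) set set \<Rightarrow> ('a ^ 4) set set" where
  "extended_generators S Q' = {l \<in> pg_lines. \<exists>g\<in>baer_generators S Q'. g \<subseteq> points_on l}"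

end

theory Submission
  imports Defs "HOL-Computational_Algebra.Polynomial"
begin

text \<open>
  Let \<open>P = \<langle>p\<rangle>\<close>, let \<open>h\<close> and \<open>b\<close> be the Hermitian and the symmetric form, and \<open>\<pi>\<close> the common tangent
  plane at \<open>P\<close>. A common zero outside \<open>\<pi>\<close> has the form \<open>e + x u + y w + z p\<close> with \<open>p, u, w\<close> spanning
  \<open>\<pi>\<close>, where \<open>b = 0\<close> determines \<open>z\<close> from \<open>x, y\<close>.
  If \<open>P\<close> is the only common point in \<open>\<pi>\<close>, then for fixed \<open>y\<close> the remaining equation is a nonzero
  polynomial of degree at most \<open>2q\<close> in \<open>x\<close>, so there are at most \<open>2q\<^sup>3 + 1\<close> common points, which is
  too few. Otherwise take \<open>u\<close> to be a common zero in \<open>\<pi>\<close>; completing \<open>p, u\<close> to a hyperbolic basis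
  for \<open>h\<close>, the remaining equation becomes \<open>Tr (k(y) x) = Tr (G(y))\<close> with \<open>k\<close> additive up to a constant
  and of degree \<open>q\<close>. Counting its solutions shows that \<open>2q\<^sup>3 + q\<^sup>2 + 1\<close> is attained only if \<open>k\<close>
  has \<open>q\<close> zeros, \<open>Tr (G(y)) = 0\<close> at each of them, and \<open>\<pi>\<close> contains a second line of common points.
  These conditions allow the basis to be changed so that \<open>b\<close> is a multiple of \<open>tz - xy\<close> while
  \<open>h = Tr (t z\<^sup>q - x y\<^sup>q)\<close>. On the common points with \<open>t = 1\<close> this gives
  \<open>(x - x\<^sup>q) (y - y\<^sup>q) = 0\<close>, whence the extended generators.
\<close>

section \<open>Finite fields of square order\<close>

text \<open>Writing the conjugate of \<open>x\<close> as \<open>x ^ n\<close> turns a mixed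
  quadratic and Hermitian condition into such a polynomial. For \<open>n \<ge> 3\<close> the
  exponents 0, 1, 2, n, n + 1, 2n are distinct, so a nonzero \<open>k4\<close> or \<open>k5\<close>
  makes it a nonzero polynomial.\<close>

lemma card_sparse_poly_roots_le:
  fixes k0 :: "'a::{field,finite}"
  assumes "n \<ge> 3" "k4 \<noteq> 0 \<or> k5 \<noteq> 0"
  shows "card {x. k0 + k1 * x + k2 * x\<^sup>2 + k3 * x ^ n + k4 * x ^ (n + 1) + k5 * x ^ (2 * n) = 0}
    \<le> 2 * n"
proof -
  define f where "f = monom k0 0 + monom k1 1 + monom k2 2 + monom k3 n + monom k4 (n + 1)
    + monom k5 (2 * n)"
  have "coeff f (2 * n) = k5" "coeff f (n + 1) = k4"
    using assms(1) by (auto simp: f_def)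
  then have "f \<noteq> 0" using assms(2) by auto
  have "degree f \<le> 2 * n"
    unfolding f_def using assms(1)
    by (intro degree_add_le order.trans[OF degree_monom_le]) auto
  moreover have "{x. k0 + k1 * x + k2 * x\<^sup>2 + k3 * x ^ n + k4 * x ^ (n + 1) + k5 * x ^ (2 * n) = 0}
      = {x. poly f x = 0}"
    by (simp add: f_def poly_monom)
  ultimately show ?thesis
    using card_poly_roots_bound[OF \<open>f \<noteq> 0\<close>] by simp
qed

text \<open>Bounds the fixed elements of conjugation, the kernel of the trace and, later, the zeros
  of \<open>k\<close>.\<close>

lemma card_trinomial_roots_le:
  fixes k0 :: "'a::{field,finite}"
  assumes "n \<ge> 2"
  shows "card {x. x ^ n + k1 * x + k0 = 0} \<le> n"
proof -
  define f where "f = monom k0 0 + monom k1 1 + monom 1 n"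
  have "coeff f n = 1"
    using assms(1) by (auto simp: f_def)
  then have "f \<noteq> 0" by auto
  have "degree f \<le> n"
    unfolding f_def using assms(1)
    by (intro degree_add_le order.trans[OF degree_monom_le]) auto
  moreover have "{x. x ^ n + k1 * x + k0 = 0} = {x. poly f x = 0}"
    by (simp add: f_def poly_monom add_ac)
  ultimately show ?thesis
    using card_poly_roots_bound[OF \<open>f \<noteq> 0\<close>] by simp
qed

text \<open>Multiplication by a nonzero \<open>x\<close> permutes the nonzero elements, so their
  product absorbs one factor \<open>x\<close> for each of them.\<close>

lemma power_card_field_eq_same:
  fixes x :: "'a::{field,finite}"
  shows "x ^ CARD('a) = x"
proof (cases "x = 0")
  case False
  have "(\<Prod>y\<in>UNIV - {0}. x * y) = \<Prod>(UNIV - {0})"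
    by (rule prod.reindex_bij_witness[of _ "\<lambda>y. y / x" "\<lambda>y. x * y"]) (use False in auto)
  moreover have "(\<Prod>y\<in>UNIV - {0}. x * y) = x ^ card (UNIV - {0::'a}) * \<Prod>(UNIV - {0})"
    by (simp add: prod.distrib)
  moreover have "\<Prod>(UNIV - {0::'a}) \<noteq> 0"
    by simp
  ultimately have "x ^ (CARD('a) - 1) = 1"
    by (simp add: card_Diff_singleton)
  then have "x ^ Suc (CARD('a) - 1) = x" by (simp only: power_Suc mult_1_right)
  moreover have "Suc (CARD('a) - 1) = CARD('a)"
    using zero_less_card_finite[where 'a='a] by linarith
  ultimately show ?thesis by simp
qed (simp add: power_0_left)

section \<open>Conjugation and trace over a field of order \<open>q\<^sup>2\<close>\<close>

locale square_order_field =
  fixes q :: nat and cj :: "'a::{field,finite} \<Rightarrow> 'a"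
  assumes q_primepow: "primepow q" and q_odd: "odd q" and card_field: "CARD('a) = q\<^sup>2"
    and cj_eq: "\<And>x. cj x = x ^ q"
begin

lemma q_ge_3: "q \<ge> 3"
proof -
  have "q > 1" using primepow_gt_Suc_0[OF q_primepow] by simp
  moreover have "q \<noteq> 2" using q_odd by auto
  ultimately show ?thesis by linarith
qed

text \<open>Translation by 1 permutes the field, so \<open>CARD('a)\<close> copies of 1 add up to 0
  and the characteristic divides \<open>q\<^sup>2\<close>. This makes conjugation a power of
  Frobenius and hence additive.\<close>

lemma q_prime_power: obtains n where "q = CHAR('a) ^ n" "prime CHAR('a)"
proof -
  obtain p n where pn: "prime p" "q = p ^ n"
    using q_primepow by (auto simp: primepow_def)
  have pr: "prime CHAR('a)"
    by (rule prime_CHAR_semidom) (rule finite_imp_CHAR_pos, simp)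
  have "CHAR('a) dvd q\<^sup>2"
  proof -
    have "(\<Sum>x\<in>UNIV. x + 1) = \<Sum>(UNIV :: 'a set)"
      by (rule sum.reindex_bij_witness[of _ "\<lambda>x. x - 1" "\<lambda>x. x + 1"]) auto
    then have "of_nat CARD('a) = (0::'a)"
      by (simp add: sum.distrib)
    then show ?thesis
      by (simp only: of_nat_eq_0_iff_char_dvd card_field)
  qed
  then have "CHAR('a) dvd p"
    using pr pn by (metis prime_dvd_power)
  then have "CHAR('a) = p"
    using pr pn primes_dvd_imp_eq by blast
  with that pn show ?thesis by blast
qed

lemma cj_add [simp]: "cj (x + y) = cj x + cj y"
proof -
  obtain n where "q = CHAR('a) ^ n" "prime CHAR('a)" by (rule q_prime_power)
  then show ?thesis unfolding cj_eq using freshmans_dream'[of q n x y] by simp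
qed

lemma cj_0 [simp]: "cj 0 = 0"
  using q_ge_3 by (simp add: cj_eq)

lemma cj_1 [simp]: "cj 1 = 1"
  by (simp add: cj_eq)

lemma cj_mult [simp]: "cj (x * y) = cj x * cj y"
  by (simp add: cj_eq power_mult_distrib)

lemma cj_minus [simp]: "cj (- x) = - cj x"
  using q_odd by (simp add: cj_eq)

lemma cj_diff [simp]: "cj (x - y) = cj x - cj y"
  using cj_add[of x "- y"] by simp

lemma cj_divide [simp]: "cj (x / y) = cj x / cj y"
  by (simp add: cj_eq power_divide)

lemma cj_power [simp]: "cj (x ^ n) = cj x ^ n"
  by (simp add: cj_eq flip: power_mult) (simp add: mult.commute)

lemma cj_2 [simp]: "cj 2 = 2"
  using cj_add[of 1 1] by simp

lemma cj_cj [simp]: "cj (cj x) = x"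
  using power_card_field_eq_same[of x]
  by (simp add: cj_eq card_field power2_eq_square flip: power_mult)

lemma cj_eq_0_iff [simp]: "cj x = 0 \<longleftrightarrow> x = 0"
  using q_ge_3 by (simp add: cj_eq)

lemma cj_sum: "cj (sum f S) = (\<Sum>i\<in>S. cj (f i))"
  by (induction S rule: infinite_finite_induct) auto

lemma two_neq_0 [simp]: "(2::'a) \<noteq> 0"
proof
  assume "(2::'a) = 0"
  then have "CHAR('a) dvd 2"
    by (metis of_nat_eq_0_iff_char_dvd of_nat_numeral)
  moreover obtain n where n: "q = CHAR('a) ^ n" "prime CHAR('a)" by (rule q_prime_power)
  ultimately have "CHAR('a) = 2"
    using primes_dvd_imp_eq two_is_prime_nat by blast
  with n q_odd q_ge_3 show False by (cases n) auto
qed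

text \<open>Halving \<open>x + cj x\<close> and \<open>x - cj x\<close> splits the field into fixed
  elements and elements of trace zero. Both sets consist of roots of a polynomial of degree
  \<open>q\<close>, and the product of their sizes is \<open>q\<^sup>2\<close>, so both have exactly
  \<open>q\<close> elements.\<close>

lemma card_trace_zero: "card {x. x + cj x = 0} = q"
proof -
  let ?R = "{x. cj x = x}" and ?I = "{x. x + cj x = 0}"
  have R: "card ?R \<le> q"
    using card_trinomial_roots_le[of q "- 1" "0::'a"] q_ge_3 by (simp add: cj_eq)
  have I: "card ?I \<le> q"
    using card_trinomial_roots_le[of q 1 "0::'a"] q_ge_3 by (simp add: cj_eq add.commute)
  have "bij_betw (\<lambda>(r, i). r + i) (?R \<times> ?I) UNIV"
    unfolding bij_betw_def
  proof
    show "inj_on (\<lambda>(r, i). r + i) (?R \<times> ?I)"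
    proof (rule inj_onI, clarify)
      have *: "(r + i) + cj (r + i) = 2 * r" if "cj r = r" "i + cj i = 0" for r i
      proof -
        have "(r + i) + cj (r + i) = (r + cj r) + (i + cj i)"
          by (simp add: algebra_simps)
        also have "\<dots> = 2 * r" by (simp only: that mult_2 add_0_right)
        finally show ?thesis .
      qed
      fix r i r' i'
      assume ri: "cj r = r" "i + cj i = 0" "cj r' = r'" "i' + cj i' = 0" and eq: "r + i = r' + i'"
      have "2 * r = 2 * r'"
        using *[OF ri(1,2)] *[OF ri(3,4)] eq by (simp only:)
      then have "r = r'" by simp
      with eq show "r = r' \<and> i = i'" by simp
    qed
    have "x \<in> (\<lambda>(r, i). r + i) ` (?R \<times> ?I)" for x
      by (rule image_eqI[of _ _ "((x + cj x) / 2, (x - cj x) / 2)"])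
        (auto simp: add.commute simp flip: add_divide_distrib)
    then show "(\<lambda>(r, i). r + i) ` (?R \<times> ?I) = UNIV" by auto
  qed
  from bij_betw_same_card[OF this] have prod: "card ?R * card ?I = q * q"
    by (simp add: card_cartesian_product card_field power2_eq_square)
  show ?thesis
  proof (rule ccontr)
    assume "card ?I \<noteq> q"
    with I have "card ?I < q" by simp
    then have "q * card ?I < q * q"
      using q_ge_3 by simp
    moreover have "card ?R * card ?I \<le> q * card ?I"
      using R by (rule mult_le_mono1)
    ultimately show False using prod by simp
  qed
qed

text \<open>Since \<open>cj\<close> fixes \<open>g\<close>, the trace of \<open>g / 2\<close> is
  \<open>g\<close>; multiplying by \<open>k\<close> and subtracting \<open>g / 2\<close> reduces the
  count to the kernel of the trace.\<close>

lemma card_trace_eq: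
  assumes "k \<noteq> 0" "cj g = g"
  shows "card {x. k * x + cj (k * x) = g} = q"
proof -
  have half: "(x - g / 2) + cj (x - g / 2) = (x + cj x) - g" for x
  proof -
    have "(x - g / 2) + cj (x - g / 2) = (x + cj x) - (g / 2 + g / 2)"
      using assms(2) by (simp add: algebra_simps)
    then show ?thesis by simp
  qed
  have "bij_betw (\<lambda>x. k * x - g / 2) {x. k * x + cj (k * x) = g} {x. x + cj x = 0}"
  proof (rule bij_betw_byWitness[where f' = "\<lambda>x. (x + g / 2) / k"])
    show "(\<lambda>x. k * x - g / 2) ` {x. k * x + cj (k * x) = g} \<subseteq> {x. x + cj x = 0}"
      by (rule image_subsetI) (simp only: mem_Collect_eq half diff_self)
    show "(\<lambda>x. (x + g / 2) / k) ` {x. x + cj x = 0} \<subseteq> {x. k * x + cj (k * x) = g}"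
    proof (rule image_subsetI, simp only: mem_Collect_eq)
      fix x assume "x + cj x = 0"
      then show "k * ((x + g / 2) / k) + cj (k * ((x + g / 2) / k)) = g"
        using half[of "x + g / 2"] assms(1) by (simp del: cj_add cj_divide cj_mult)
    qed
  qed (use assms in auto)
  from bij_betw_same_card[OF this] show ?thesis
    by (simp only: card_trace_zero)
qed

text \<open>A \<open>y\<close> with \<open>k y \<noteq> 0\<close> contributes \<open>q\<close>
  values of \<open>x\<close>; a zero of \<open>k\<close> contributes the whole field or nothing,
  according to whether \<open>g y\<close> vanishes. The negative term is moved to the left to stay
  within the natural numbers.\<close>

lemma card_trace_pencil:
  fixes k g :: "'a \<Rightarrow> 'a"
  assumes "\<And>y. cj (g y) = g y"
  shows "card {(y, x). k y * x + cj (k y * x) = g y} + q * card {y. k y = 0}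
    = q ^ 3 + q\<^sup>2 * card {y. k y = 0 \<and> g y = 0}"
proof -
  let ?Z = "{y. k y = 0}"
  have eq: "{(y, x). k y * x + cj (k y * x) = g y} 
    = Sigma UNIV (\<lambda>y. {x. k y * x + cj (k y * x) = g y})"
    by auto
  have "card {(y, x). k y * x + cj (k y * x) = g y}
    = (\<Sum>y\<in>UNIV. card {x. k y * x + cj (k y * x) = g y})"
    unfolding eq by (rule card_SigmaI) simp_all
  also have "\<dots> = (\<Sum>y\<in>UNIV. if k y = 0 then (if g y = 0 then q\<^sup>2 else 0) else q)"
    by (intro sum.cong) (auto simp: card_trace_eq assms card_field simp del: cj_mult)
  also have "\<dots> = (\<Sum>y\<in>?Z. if g y = 0 then q\<^sup>2 else 0) + (\<Sum>y\<in>- ?Z. q)"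
    by (subst sum.If_cases) (auto simp: Collect_neg_eq)
  also have "(\<Sum>y\<in>?Z. if g y = 0 then q\<^sup>2 else 0) = q\<^sup>2 * card {y. k y = 0 \<and> g y = 0}"
    by (subst sum.If_cases) (auto simp: Int_def)
  also have "(\<Sum>y\<in>- ?Z. q) = q * card (- ?Z)" by simp
  finally have "card {(y, x). k y * x + cj (k y * x) = g y}
    = q\<^sup>2 * card {y. k y = 0 \<and> g y = 0} + q * card (- ?Z)" .
  moreover have "card (- ?Z) + card ?Z = q\<^sup>2"
    using card_Un_disjoint[of "- ?Z" ?Z] by (simp add: Compl_partition2 card_field)
  then have "q * card (- ?Z) + q * card ?Z = q ^ 3"
    by (metis add_mult_distrib2 power2_eq_square power3_eq_cube mult.assoc)
  ultimately show ?thesis by linarith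
qed

end

text \<open>In the application \<open>n\<close> counts the common points off the tangent plane,
  \<open>q\<^sup>2 * c\<close> the common zero vectors in it, \<open>Y\<close> the zeros of
  \<open>k\<close>, and \<open>Y0\<close> those zeros at which the trace condition holds.\<close>

lemma extremal_arithmetic:
  fixes q n c Y Y0 :: nat
  assumes q: "q \<ge> 3"
    and tot: "(q\<^sup>2 - 1) * n + q\<^sup>2 * c = (q\<^sup>2 - 1) * (2 * q ^ 3 + q\<^sup>2) + q\<^sup>2"
    and n: "n + q * Y = q ^ 3 + q\<^sup>2 * Y0" and Y: "Y0 \<le> Y" "Y \<le> q"
  shows "Y \<noteq> 1" and "c \<noteq> q\<^sup>2" and "c \<le> q\<^sup>2 + (q\<^sup>2 - 1) \<Longrightarrow> Y = q \<and> Y0 = q"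
proof -
  define Q N C y y0 where "Q = int q" and "N = int n" and "C = int c" and "y = int Y" and "y0 = int Y0"
  have Q: "Q \<ge> 3" using q by (simp add: Q_def)
  have "int (q\<^sup>2 - 1) = Q\<^sup>2 - 1"
    using one_less_power[of q 2] q by (simp add: Q_def of_nat_diff)
  with arg_cong[OF tot, of int] have tot': "(Q\<^sup>2 - 1) * N + Q\<^sup>2 * C
      = (Q\<^sup>2 - 1) * (2 * Q ^ 3 + Q\<^sup>2) + Q\<^sup>2"
    by (simp add: Q_def N_def C_def)
  from arg_cong[OF n, of int] have n': "N + Q * y = Q ^ 3 + Q\<^sup>2 * y0"
    by (simp add: Q_def N_def y_def y0_def)
  have y: "0 \<le> y0" "y0 \<le> y" "y \<le> Q" using Y by (simp_all add: Q_def y_def y0_def)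
  have Q2: "Q\<^sup>2 - 1 > 0" using Q power_mono[of 3 Q 2] by simp
  show "Y \<noteq> 1"
  proof
    assume "Y = 1"
    then have "y = 1" by (simp add: y_def)
    \<comment> \<open>Modulo \<open>Q\<^sup>2\<close>, \<open>tot'\<close> says that
      \<open>N\<close> is 0 and \<open>n'\<close> that it is \<open>- Q\<close>; the identity makes
      the quotient explicit.\<close>
    have "Q = Q\<^sup>2 * (Q + y0 - (N + C - (Q\<^sup>2 - 1) * (2 * Q + 1) - 1))"
      using tot' n' \<open>y = 1\<close> by algebra
    then have "Q * 1 = Q * (Q * (Q + y0 - (N + C - (Q\<^sup>2 - 1) * (2 * Q + 1) - 1)))"
      by (simp add: power2_eq_square mult.assoc)
    then have "1 = Q * (Q + y0 - (N + C - (Q\<^sup>2 - 1) * (2 * Q + 1) - 1))"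
      using Q by (simp only: mult_cancel_left) simp
    then have "Q dvd 1" by (metis dvd_triv_left)
    with Q show False by simp
  qed
  have up: "Q * (Q - 1) * (Q - y) \<ge> 0" "Q * (Q - 1) * (y - y0) \<ge> 0"
    using Q y by simp_all
  \<comment> \<open>The amount by which \<open>N\<close> falls short of
    \<open>2 * Q ^ 3 - Q\<^sup>2\<close> is a sum of two nonnegative terms, and both vanish only for
    \<open>Y0 = Y = q\<close>.\<close>
  have bound: "2 * Q ^ 3 - Q\<^sup>2 - N = Q * (Q - 1) * (Q - y) + Q\<^sup>2 * (y - y0)"
    using n' by algebra
  have nn: "Q\<^sup>2 * (y - y0) \<ge> 0" using y by simp
  show "c \<noteq> q\<^sup>2"
  proof
    assume "c = q\<^sup>2"
    then have "C = Q\<^sup>2" by (simp add: C_def Q_def)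
    then have "(Q\<^sup>2 - 1) * N = (Q\<^sup>2 - 1) * (2 * Q ^ 3)"
      using tot' by algebra
    then have "N = 2 * Q ^ 3" using Q2 by simp
    with bound nn up have "Q\<^sup>2 \<le> 0" by linarith
    with Q2 show False by linarith
  qed
  show "Y = q \<and> Y0 = q" if "c \<le> q\<^sup>2 + (q\<^sup>2 - 1)"
  proof -
    have "c + 1 \<le> q\<^sup>2 + q\<^sup>2" using that one_less_power[of q 2] q by simp
    then have "int (c + 1) \<le> int (q\<^sup>2 + q\<^sup>2)" by (simp only: of_nat_le_iff)
    then have "2 * Q\<^sup>2 - 1 - C \<ge> 0" by (simp add: C_def Q_def)
    then have "Q\<^sup>2 * (2 * Q\<^sup>2 - 1 - C) \<ge> 0" by simp
    \<comment> \<open>The upper bound on \<open>C\<close> bounds \<open>N\<close> from below by the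
      value that \<open>bound\<close> gives from above.\<close>
    moreover have "(Q\<^sup>2 - 1) * (2 * Q ^ 3 - Q\<^sup>2 - N) = - (Q\<^sup>2 * (2 * Q\<^sup>2 - 1 - C))"
      using tot' by algebra
    ultimately have "(Q\<^sup>2 - 1) * (2 * Q ^ 3 - Q\<^sup>2 - N) \<le> 0" by linarith
    then have "2 * Q ^ 3 - Q\<^sup>2 - N \<le> 0" using Q2 by (simp add: mult_le_0_iff)
    with bound nn up have "Q * (Q - 1) * (Q - y) = 0" "Q\<^sup>2 * (y - y0) = 0" by linarith+
    then have "Q = y" "y = y0" using Q by simp_all
    then show ?thesis by (simp add: Q_def y_def y0_def)
  qed
qed

section \<open>Forms with a common tangent plane\<close>

text \<open>The two surfaces enter only through the axioms of their forms.
  \<open>card_common_zeros\<close> counts vectors instead of points: \<open>q\<^sup>2 - 1\<close>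
  nonzero ones for each common point, and the zero vector.\<close>

locale tangent_forms = square_order_field q cj for q and cj :: "'a::{field,finite} \<Rightarrow> 'a" +
  fixes h b :: "'a ^ 4 \<Rightarrow> 'a ^ 4 \<Rightarrow> 'a" and p :: "'a ^ 4"
  assumes h_add_left: "\<And>x y z. h (x + y) z = h x z + h y z"
    and h_scale_left: "\<And>c x y. h (c *s x) y = c * h x y"
    and h_herm: "\<And>x y. h y x = cj (h x y)"
    and h_nondegenerate: "\<And>x. (\<And>v. h v x = 0) \<Longrightarrow> x = 0"
    and b_add_left: "\<And>x y z. b (x + y) z = b x z + b y z"
    and b_scale_left: "\<And>c x y. b (c *s x) y = c * b x y"
    and b_sym: "\<And>x y. b y x = b x y"
    and p_neq_0: "p \<noteq> 0" and h_p_p: "h p p = 0" and b_p_p: "b p p = 0"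
    and tangent: "\<And>v. h v p = 0 \<longleftrightarrow> b v p = 0"
    and card_common_zeros:
      "card {v. h v v = 0 \<and> b v v = 0} = (q\<^sup>2 - 1) * (2 * q ^ 3 + q\<^sup>2 + 1) + 1"
begin

lemma h_add_right: "h x (y + z) = h x y + h x z"
  by (metis cj_add h_add_left h_herm)

lemma h_scale_right: "h x (c *s y) = cj c * h x y"
  by (metis cj_mult h_scale_left h_herm)

lemma b_add_right: "b x (y + z) = b x y + b x z"
  by (metis b_add_left b_sym)

lemma b_scale_right: "b x (c *s y) = c * b x y"
  by (metis b_scale_left b_sym)

lemmas form_simps = h_add_left h_add_right h_scale_left h_scale_right
  b_add_left b_add_right b_scale_left b_scale_right

section \<open>Common zeros off and in the tangent plane at \<open>p\<close>\<close>

definition Z :: "('a ^ 4) set" where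
  "Z = {v. h v v = 0 \<and> b v v = 0}"

text \<open>Every common point off the tangent plane has exactly one representative normalised in
  this way.\<close>

definition Z1 :: "('a ^ 4) set" where
  "Z1 = {v \<in> Z. h v p = 1}"

definition Z0 :: "('a ^ 4) set" where
  "Z0 = {v \<in> Z. h v p = 0}"

lemma Z_scale: "v \<in> Z \<Longrightarrow> c *s v \<in> Z"
  by (simp add: Z_def form_simps)

lemma card_affine_and_infinite_part:
  "(q\<^sup>2 - 1) * card Z1 + card Z0 = (q\<^sup>2 - 1) * (2 * q ^ 3 + q\<^sup>2) + q\<^sup>2"
proof -
  have "bij_betw (\<lambda>(c, v). c *s v) ((UNIV - {0}) \<times> Z1) (Z - Z0)"
  proof (rule bij_betw_byWitness[where f' = "\<lambda>v. (h v p, (1 / h v p) *s v)"])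
    show "(\<lambda>(c, v). c *s v) ` ((UNIV - {0}) \<times> Z1) \<subseteq> Z - Z0"
      by (auto simp: Z1_def Z0_def Z_scale form_simps)
    show "(\<lambda>v. (h v p, (1 / h v p) *s v)) ` (Z - Z0) \<subseteq> (UNIV - {0}) \<times> Z1"
      by (auto simp: Z1_def Z0_def Z_scale form_simps)
  qed (auto simp: Z1_def Z0_def form_simps)
  from bij_betw_same_card[OF this]
  have "(q\<^sup>2 - 1) * card Z1 = card (Z - Z0)"
    by (simp add: card_cartesian_product card_Diff_singleton card_field)
  moreover have "card (Z - Z0) + card Z0 = card Z"
    using card_Un_disjoint[of "Z - Z0" Z0] by (auto simp: Z0_def Un_absorb2 Int_def)
  moreover have "card Z = (q\<^sup>2 - 1) * (2 * q ^ 3 + q\<^sup>2 + 1) + 1"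
    using card_common_zeros by (simp add: Z_def)
  moreover have "\<dots> = (q\<^sup>2 - 1) * (2 * q ^ 3 + q\<^sup>2) + q\<^sup>2"
  proof -
    have "q\<^sup>2 \<ge> 1" using q_ge_3 by simp
    then show ?thesis by (simp add: algebra_simps)
  qed
  ultimately show ?thesis by linarith
qed

definition comb :: "'a ^ 4 \<Rightarrow> 'a ^ 4 \<Rightarrow> 'a ^ 4 \<Rightarrow> 'a \<Rightarrow> 'a \<Rightarrow> 'a \<Rightarrow> 'a \<Rightarrow> 'a ^ 4" where
  "comb e u w t x y z = t *s e + x *s u + y *s w + z *s p"

text \<open>A trivial kernel makes the coordinate map injective, and its domain and codomain are
  finite of equal size.\<close>

lemma comb_surj:
  assumes inj: "\<And>t x y z. comb e u w t x y z = 0 \<Longrightarrow> t = 0 \<and> x = 0 \<and> y = 0 \<and> z = 0"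
  obtains t x y z where "v = comb e u w t x y z"
proof -
  let ?f = "\<lambda>(t, x, y, z). comb e u w t x y z"
  have diff: "comb e u w t x y z - comb e u w t' x' y' z'
    = comb e u w (t - t') (x - x') (y - y') (z - z')" for t x y z t' x' y' z'
    by (simp add: comb_def vec.scale_left_diff_distrib)
  have "inj ?f"
  proof (rule injI)
    fix s s' assume eq: "?f s = ?f s'"
    obtain t x y z where s: "s = (t, x, y, z)" by (metis prod_cases4)
    obtain t' x' y' z' where s': "s' = (t', x', y', z')" by (metis prod_cases4)
    from eq have "comb e u w (t - t') (x - x') (y - y') (z - z') = 0"
      unfolding s s' by (simp only: diff[symmetric]) simp
    from inj[OF this] show "s = s'" by (simp add: s s')
  qed
  moreover have "CARD('a ^ 4) = CARD('a \<times> 'a \<times> 'a \<times> 'a)"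
    by (simp add: numeral_eq_Suc)
  ultimately have "surj ?f"
    by (metis card_image card_seteq finite top_greatest order_refl)
  then obtain s where "v = ?f s" by (metis surjD)
  moreover obtain t x y z where "s = (t, x, y, z)" by (metis prod_cases4)
  ultimately have "v = comb e u w t x y z" by simp
  then show ?thesis by (rule that)
qed

lemma exists_affine: obtains e where "h e p = 1"
proof -
  obtain v where "h v p \<noteq> 0" using h_nondegenerate p_neq_0 by blast
  then have "h ((1 / h v p) *s v) p = 1" by (simp add: form_simps)
  with that show ?thesis by blast
qed

text \<open>Together with one affine vector \<open>e\<close> the tangent plane generates the
  four-dimensional space, so two vectors cannot span it.\<close>

lemma exists_tangent_notin_span:
  assumes "card S \<le> 2"
  obtains w where "h w p = 0" "w \<notin> vec.span S"
proof (rule ccontr)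
  assume "\<not> thesis"
  with that have sub: "h w p = 0 \<Longrightarrow> w \<in> vec.span S" for w by blast
  obtain e where e: "h e p = 1" by (rule exists_affine)
  have "v \<in> vec.span (insert e S)" for v
  proof -
    have "h (v + (- h v p) *s e) p = 0" by (simp only: form_simps e) simp
    then have "v + (- h v p) *s e \<in> vec.span S" by (rule sub)
    then have "v - h v p *s e \<in> vec.span S" by (simp add: vec.scale_minus_left)
    then show ?thesis by (auto simp: vec.span_insert)
  qed
  then have "vec.dim (UNIV :: ('a ^ 4) set) \<le> card (insert e S)"
    by (intro vec.dim_le_card) auto
  also have "\<dots> \<le> 3" using card_insert_le_m1[of 3 S e] assms by simp
  finally show False by (simp only: vec_dim_card) simp
qed

section \<open>Tangent planes whose only common point is \<open>p\<close>\<close>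

lemma b_affine_neq_0: "h e p = 1 \<Longrightarrow> b e p \<noteq> 0"
  using tangent[of e] by simp

lemma h_p_left: "h p v = cj (h v p)" by (rule h_herm)

text \<open>For fixed \<open>y\<close>, the equation \<open>b = 0\<close> is linear in
  \<open>z\<close> with coefficient \<open>2 * \<tau>\<close>. Inserting its solution into
  \<open>h = 0\<close> leaves a polynomial in \<open>x\<close> whose coefficients at
  \<open>q + 1\<close> and \<open>2 * q\<close> vanish only with \<open>h u u\<close> and
  \<open>b u u\<close>. As \<open>u\<close> is no common zero, each of the \<open>q\<^sup>2\<close>
  values of \<open>y\<close> admits at most \<open>2 * q\<close> values of \<open>x\<close>.\<close>

lemma card_Z1_le:
  assumes no: "\<And>w. h w p = 0 \<Longrightarrow> h w w = 0 \<Longrightarrow> b w w = 0 \<Longrightarrow> w \<in> vec.span {p}"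
  shows "card Z1 \<le> 2 * q ^ 3"
proof -
  obtain e where e: "h e p = 1" by (rule exists_affine)
  obtain u where u: "h u p = 0" "u \<notin> vec.span {p}"
    by (rule exists_tangent_notin_span[of "{p}"]) auto
  obtain w where w: "h w p = 0" "w \<notin> vec.span {p, u}"
    by (rule exists_tangent_notin_span[of "{p, u}"]) (auto simp: card_insert_if)
  have inj: "t = 0 \<and> x = 0 \<and> y = 0 \<and> z = 0" if eq: "comb e u w t x y z = 0" for t x y z
  proof -
    have "h (comb e u w t x y z) p = t"
      by (simp add: comb_def form_simps e u w h_p_p)
    moreover have "h 0 p = 0" using h_scale_left[of 0 0 p] by simp
    ultimately have t: "t = 0" using eq by simp
    have y: "y = 0"
    proof (rule ccontr)
      assume "y \<noteq> 0"
      have "y *s w = - (x *s u + z *s p)"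
        using eq t by (simp only: eq_neg_iff_add_eq_0) (simp add: comb_def add_ac)
      also have "\<dots> \<in> vec.span {p, u}"
        by (intro vec.span_neg vec.span_add vec.span_scale vec.span_base) auto
      finally have "(1 / y) *s (y *s w) \<in> vec.span {p, u}" by (rule vec.span_scale)
      then show False using w \<open>y \<noteq> 0\<close> by simp
    qed
    have x: "x = 0"
    proof (rule ccontr)
      assume "x \<noteq> 0"
      have "x *s u = - (z *s p)"
        using eq t y by (simp only: eq_neg_iff_add_eq_0) (simp add: comb_def)
      also have "\<dots> \<in> vec.span {p}"
        by (intro vec.span_neg vec.span_scale vec.span_base) auto
      finally have "(1 / x) *s (x *s u) \<in> vec.span {p}" by (rule vec.span_scale)
      then show False using u \<open>x \<noteq> 0\<close> by simp
    qed
    show ?thesis using eq t x y p_neq_0 by (simp add: comb_def)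
  qed
  have "\<not> (h u u = 0 \<and> b u u = 0)" using no u by blast
  define F where "F y = {v \<in> Z. \<exists>x z. v = comb e u w 1 x y z}" for y
  have "card (F y) \<le> 2 * q" for y
  proof -
    define v0 where "v0 = e + y *s w"
    have v0p: "h v0 p = 1" by (simp add: v0_def form_simps e w)
    have comb: "comb e u w 1 x y z = v0 + x *s u + z *s p" for x z
      by (simp add: comb_def v0_def add_ac)
    define \<tau> where "\<tau> = b v0 p"
    have \<tau>: "\<tau> \<noteq> 0" using b_affine_neq_0[OF v0p] by (simp add: \<tau>_def)
    have bup: "b u p = 0" "b p u = 0" using tangent u b_sym by auto
    \<comment> \<open>The coefficients of \<open>z\<close> as a polynomial in \<open>x\<close>,
      found by solving \<open>b = 0\<close>.\<close>
    define c0 c1 c2 where "c0 = - b v0 v0 / (2 * \<tau>)" and "c1 = - b v0 u / \<tau>"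
      and "c2 = - b u u / (2 * \<tau>)"
    have c: "2 * \<tau> * c0 = - b v0 v0" "\<tau> * c1 = - b v0 u" "2 * \<tau> * c2 = - b u u" "(2::'a) \<noteq> 0"
      using \<tau> by (simp_all add: c0_def c1_def c2_def)
    have z: "z = c0 + c1 * x + c2 * x\<^sup>2"
      and hz: "h v0 v0 + (x * h u v0 + cj x * h v0 u) + x * cj x * h u u + (z + cj z) = 0"
      if "v0 + x *s u + z *s p \<in> Z" for x z
    proof -
      have "b v0 v0 + 2 * x * b v0 u + x\<^sup>2 * b u u + 2 * \<tau> * z = 0"
        using that by (simp add: Z_def form_simps bup b_p_p b_sym[of v0 u] b_sym[of v0 p] \<tau>_def
            algebra_simps power2_eq_square)
      then show "z = c0 + c1 * x + c2 * x\<^sup>2"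
        using \<tau> c by algebra
      show "h v0 v0 + (x * h u v0 + cj x * h v0 u) + x * cj x * h u u + (z + cj z) = 0"
        using that by (simp add: Z_def form_simps h_p_left[of v0] h_p_left[of u] v0p u h_p_p algebra_simps)
    qed
    define X where "X = {x. (h v0 v0 + c0 + cj c0) + (h u v0 + c1) * x + c2 * x\<^sup>2
      + (h v0 u + cj c1) * x ^ q + h u u * x ^ (q + 1) + cj c2 * x ^ (2 * q) = 0}"
    have "F y \<subseteq> (\<lambda>x. v0 + x *s u + (c0 + c1 * x + c2 * x\<^sup>2) *s p) ` X"
    proof
      fix v assume "v \<in> F y"
      then obtain x z where v: "v = v0 + x *s u + z *s p" and Z: "v0 + x *s u + z *s p \<in> Z"
        by (auto simp: F_def comb)
      have pw: "cj x = x ^ q" "cj x * x = x ^ (q + 1)" "(cj x)\<^sup>2 = x ^ (2 * q)"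
        by (simp_all add: cj_eq mult.commute flip: power_mult)
      have "x \<in> X"
        using hz[OF Z] z[OF Z] unfolding X_def mem_Collect_eq pw[symmetric]
        by (simp add: algebra_simps)
      then show "v \<in> (\<lambda>x. v0 + x *s u + (c0 + c1 * x + c2 * x\<^sup>2) *s p) ` X"
        using v z[OF Z] by auto
    qed
    then have "card (F y) \<le> card X" by (rule surj_card_le[rotated]) simp
    also have "\<dots> \<le> 2 * q"
      unfolding X_def using \<open>\<not> (h u u = 0 \<and> b u u = 0)\<close> \<tau> q_ge_3
      by (intro card_sparse_poly_roots_le) (auto simp: c2_def)
    finally show ?thesis .
  qed
  moreover have "Z1 \<subseteq> (\<Union>y. F y)"
  proof
    fix v assume v: "v \<in> Z1"
    obtain t x y z where eq: "v = comb e u w t x y z" using comb_surj[OF inj] by blast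
    have "h (comb e u w t x y z) p = t"
      by (simp add: comb_def form_simps e u w h_p_p)
    with v eq have "t = 1" by (simp add: Z1_def)
    with v eq show "v \<in> (\<Union>y. F y)" by (auto simp: F_def Z1_def)
  qed
  ultimately have "card Z1 \<le> (\<Sum>y\<in>(UNIV :: 'a set). 2 * q)"
    by (intro order.trans[OF card_mono order.trans[OF card_UN_le sum_mono]]) auto
  then show ?thesis by (simp add: card_field power2_eq_square power3_eq_cube)
qed

text \<open>Otherwise \<open>Z0\<close> consists of the \<open>q\<^sup>2\<close> multiples of
  \<open>p\<close>, and the total forces \<open>card Z1\<close> to exceed the bound of
  \<open>card_Z1_le\<close> by \<open>q\<^sup>2\<close>.\<close>

lemma exists_common_zero:
  obtains u where "h u p = 0" "h u u = 0" "b u u = 0" "u \<notin> vec.span {p}"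
proof (rule ccontr)
  assume "\<not> thesis"
  with that have no: "\<And>w. h w p = 0 \<Longrightarrow> h w w = 0 \<Longrightarrow> b w w = 0 \<Longrightarrow> w \<in> vec.span {p}"
    by blast
  have "Z0 = range (\<lambda>c. c *s p)"
  proof
    show "Z0 \<subseteq> range (\<lambda>c. c *s p)" using no by (auto simp: Z0_def Z_def vec.span_singleton)
    show "range (\<lambda>c. c *s p) \<subseteq> Z0" by (auto simp: Z0_def Z_def form_simps h_p_p b_p_p)
  qed
  moreover have "inj (\<lambda>c. c *s p)" using p_neq_0 by (auto intro!: injI)
  ultimately have "card Z0 = q\<^sup>2" by (simp add: card_image card_field)
  then have "(q\<^sup>2 - 1) * card Z1 = (q\<^sup>2 - 1) * (2 * q ^ 3 + q\<^sup>2)"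
    using card_affine_and_infinite_part by simp
  moreover have "q\<^sup>2 - 1 \<noteq> 0" using one_less_power[of q 2] q_ge_3 by simp
  ultimately have "card Z1 = 2 * q ^ 3 + q\<^sup>2" by simp
  moreover have "card Z1 \<le> 2 * q ^ 3" by (rule card_Z1_le[OF no])
  moreover have "q\<^sup>2 > 0" using q_ge_3 by simp
  ultimately show False by linarith
qed

section \<open>Hyperbolic bases containing a common zero\<close>

lemma h_zero_left [simp]: "h 0 v = 0"
  using h_scale_left[of 0 0 v] by simp

lemma h_diag_real: "cj (h v v) = h v v"
  using h_herm[of v v] by simp

text \<open>If every vector orthogonal to \<open>y\<close> were orthogonal to \<open>x\<close>, the
  functionals \<open>\<lambda>e. h e x\<close> and \<open>\<lambda>e. h e y\<close> would be
  proportional, and nondegeneracy would put \<open>x\<close> into the span of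
  \<open>y\<close>.\<close>

lemma exists_dual_vector:
  assumes "x \<notin> vec.span {y}" "y \<noteq> 0"
  obtains e where "h e x = 1" "h e y = 0"
proof (rule ccontr)
  assume "\<not> thesis"
  with that have no: "\<not> (h e x = 1 \<and> h e y = 0)" for e by blast
  have *: "h e x = 0" if "h e y = 0" for e
  proof (rule ccontr)
    assume "h e x \<noteq> 0"
    then have "h ((1 / h e x) *s e) x = 1" "h ((1 / h e x) *s e) y = 0"
      using \<open>h e y = 0\<close> by (simp_all add: form_simps)
    with no show False by blast
  qed
  obtain f' where "h f' y \<noteq> 0" using h_nondegenerate assms(2) by blast
  then have f: "h ((1 / h f' y) *s f') y = 1" by (simp add: form_simps)
  define f where "f = (1 / h f' y) *s f'"
  \<comment> \<open>The factor is conjugated because \<open>h\<close> is semilinear in its second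
    argument.\<close>
  have "h v (x + (- cj (h f x)) *s y) = 0" for v
  proof -
    have "h (v + (- h v y) *s f) y = 0"
      using f unfolding f_def[symmetric] by (simp only: form_simps) simp
    then have "h (v + (- h v y) *s f) x = 0" by (rule *)
    then show ?thesis
      by (simp only: form_simps cj_minus cj_cj) (simp add: mult.commute)
  qed
  then have "x + (- cj (h f x)) *s y = 0" by (rule h_nondegenerate)
  then have "x = cj (h f x) *s y" by (simp add: vec.scale_minus_left)
  then have "x \<in> vec.span {y}" by (auto simp: vec.span_singleton)
  with assms(1) show False by blast
qed

text \<open>Two mutually orthogonal hyperbolic pairs, \<open>e, p\<close> and \<open>u, w\<close>.
  The sign of \<open>h u w\<close> makes \<open>h\<close> the trace of
  \<open>t * cj z - x * cj y\<close> in coordinates.\<close>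

definition frame :: "'a ^ 4 \<Rightarrow> 'a ^ 4 \<Rightarrow> 'a ^ 4 \<Rightarrow> bool" where
  "frame e u w \<longleftrightarrow> h e e = 0 \<and> h u u = 0 \<and> h w w = 0 \<and> h e u = 0 \<and> h e w = 0 \<and> h e p = 1
    \<and> h u w = - 1 \<and> h u p = 0 \<and> h w p = 0"

lemma frame_gram:
  assumes "frame e u w"
  shows "h e e = 0" "h u u = 0" "h w w = 0" "h e u = 0" "h e w = 0" "h e p = 1"
    "h u w = - 1" "h u p = 0" "h w p = 0" "h u e = 0" "h w e = 0" "h p e = 1" "h w u = - 1"
    "h p u = 0" "h p w = 0"
    "b u p = 0" "b w p = 0" "b p u = 0" "b p w = 0" "b e p \<noteq> 0"
proof -
  show f: "h e e = 0" "h u u = 0" "h w w = 0" "h e u = 0" "h e w = 0" "h e p = 1"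
    "h u w = - 1" "h u p = 0" "h w p = 0"
    using assms by (simp_all add: frame_def)
  show "h u e = 0" by (simp add: h_herm[of u e] f)
  show "h w e = 0" by (simp add: h_herm[of w e] f)
  show "h p e = 1" by (simp add: h_herm[of p e] f)
  show "h w u = - 1" by (simp add: h_herm[of w u] f)
  show "h p u = 0" by (simp add: h_herm[of p u] f)
  show "h p w = 0" by (simp add: h_herm[of p w] f)
  show bp: "b u p = 0" "b w p = 0" using f tangent by auto
  show "b p u = 0" "b p w = 0" using bp b_sym by auto
  show "b e p \<noteq> 0" by (rule b_affine_neq_0) fact
qed

lemma frame_swap:
  assumes "frame e u w"
  shows "frame e w u"
  by (simp add: frame_def frame_gram[OF assms])

text \<open>A common zero \<open>u\<close> in the tangent plane is given. Dual vectors provide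
  partners for \<open>p\<close> and for \<open>u\<close>, and multiples of \<open>p\<close> and
  \<open>u\<close> then remove the unwanted products without disturbing the pairing.\<close>

lemma exists_frame: obtains e u w where "frame e u w" "b u u = 0"
proof -
  obtain u where u: "h u p = 0" "h u u = 0" "b u u = 0" "u \<notin> vec.span {p}"
    by (rule exists_common_zero)
  have "u \<noteq> 0" using u(4) vec.span_zero by auto
  have pu: "p \<notin> vec.span {u}"
  proof
    assume "p \<in> vec.span {u}"
    then obtain c where c: "p = c *s u" by (auto simp: vec.span_singleton)
    then have "c \<noteq> 0" using p_neq_0 by auto
    with c have "u = (1 / c) *s p" by simp
    then show False using u(4) by (auto simp: vec.span_singleton)
  qed
  have hpu: "h p u = 0" by (simp add: h_herm[of p u] u)
  obtain e0 where e0: "h e0 p = 1" "h e0 u = 0"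
    using exists_dual_vector[OF pu \<open>u \<noteq> 0\<close>] by blast
  have pe0: "h p e0 = 1" "h u e0 = 0" by (simp_all add: h_herm[of p e0] h_herm[of u e0] e0)
  \<comment> \<open>As \<open>h e0 e0\<close> is fixed by \<open>cj\<close>, this \<open>c\<close>
    has trace \<open>- h e0 e0\<close>, which makes \<open>e\<close> isotropic.\<close>
  define c where "c = - h e0 e0 / 2"
  have c: "c + (cj c + h e0 e0) = 0"
    by (simp add: c_def h_diag_real)
  define e where "e = e0 + c *s p"
  have e: "h e e = 0" "h e u = 0" "h e p = 1"
    using c by (simp_all add: e_def form_simps e0 pe0 h_p_p hpu add_ac)
  have pe: "h p e = 1" "h u e = 0" by (simp_all add: h_herm[of p e] h_herm[of u e] e)
  obtain w' where w': "h w' u = 1" "h w' p = 0"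
    using exists_dual_vector[OF u(4) p_neq_0] by blast
  \<comment> \<open>The multiple of \<open>p\<close> makes \<open>w1\<close> orthogonal to
    \<open>e\<close>; the multiple of \<open>u\<close> added in \<open>w\<close> makes it
    isotropic.\<close>
  define w1 where "w1 = (- 1) *s w' + (h w' e) *s p"
  have w1: "h w1 u = - 1" "h w1 p = 0" "h w1 e = 0"
    by (simp_all only: w1_def form_simps w' pe hpu h_p_p) simp_all
  have uw1: "h u w1 = - 1" "h p w1 = 0" "h e w1 = 0"
    by (simp_all add: h_herm[of u w1] h_herm[of p w1] h_herm[of e w1] w1)
  define w where "w = w1 + (h w1 w1 / 2) *s u"
  have "frame e u w"
    by (simp add: frame_def e u w_def form_simps w1 uw1 h_diag_real)
  with that u show ?thesis by blast
qed

section \<open>Counting in the coordinates of a frame\<close>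

lemma frame_coordinates:
  assumes "frame e u w"
  shows "h (comb e u w t x y z) p = t" "h (comb e u w t x y z) w = - x"
    "h (comb e u w t x y z) u = - y" "h (comb e u w t x y z) e = z"
  by (simp_all add: frame_gram[OF assms] comb_def form_simps h_p_p)

lemma frame_comb_surj:
  assumes "frame e u w"
  obtains t x y z where "v = comb e u w t x y z"
proof -
  have "t = 0 \<and> x = 0 \<and> y = 0 \<and> z = 0" if eq: "comb e u w t x y z = 0" for t x y z
    using frame_coordinates[OF assms, of t x y z] unfolding eq by simp
  then show ?thesis using comb_surj[of e u w v] that by blast
qed

lemma comb_mem_Z_iff:
  assumes "frame e u w" "b u u = 0"
  shows "comb e u w t x y z \<in> Z \<longleftrightarrow> t * cj z + cj t * z = x * cj y + cj x * y \<and>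
    t\<^sup>2 * b e e + 2 * t * x * b e u + 2 * t * y * b e w + 2 * t * z * b e p + 2 * x * y * b u w
      + y\<^sup>2 * b w w = 0"
proof -
  have "h (comb e u w t x y z) (comb e u w t x y z)
      = t * cj z + cj t * z - (x * cj y + cj x * y)"
    by (simp add: frame_gram[OF assms(1)] comb_def form_simps h_p_p algebra_simps)
  moreover have "b (comb e u w t x y z) (comb e u w t x y z) = t\<^sup>2 * b e e + 2 * t * x * b e u
      + 2 * t * y * b e w + 2 * t * z * b e p + 2 * x * y * b u w + y\<^sup>2 * b w w"
    by (simp add: frame_gram[OF assms(1)] assms(2) comb_def form_simps b_p_p
        b_sym[of e u] b_sym[of e w] b_sym[of e p] b_sym[of u w]
        algebra_simps power2_eq_square)
  ultimately show ?thesis by (simp add: Z_def)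
qed

text \<open>At \<open>t = 1\<close>, \<open>b = 0\<close> determines \<open>z\<close>; the functions
  \<open>k\<close> and \<open>G\<close> are chosen so that \<open>z - x * cj y\<close> equals
  \<open>k y * x - G y\<close>. Since \<open>h = 0\<close> says that \<open>z - x * cj y\<close> has
  trace zero, \<open>card_trace_pencil\<close> applies.\<close>

lemma card_Z1_eq:
  assumes fr: "frame e u w" and uu: "b u u = 0"
    and k_def: "\<And>y. k y = - (cj y + b u w / b e p * y + b e u / b e p)"
    and G_def: "\<And>y. G y = (b e e + 2 * y * b e w + y\<^sup>2 * b w w) / (2 * b e p)"
  shows "card Z1 + q * card {y. k y = 0} = q ^ 3 + q\<^sup>2 * card {y. k y = 0 \<and> G y + cj (G y) = 0}"
    and "\<And>x y z. comb e u w 1 x y z \<in> Z \<longleftrightarrow>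
      z = k y * x - G y + x * cj y \<and> k y * x + cj (k y * x) = G y + cj (G y)"
proof -
  define \<tau> where "\<tau> = b e p"
  have \<tau>: "\<tau> \<noteq> 0" "2 * \<tau> \<noteq> 0" using frame_gram(20)[OF fr] by (simp_all add: \<tau>_def)
  have k: "\<tau> * k y = - (\<tau> * cj y + b u w * y + b e u)" for y
    using \<tau> by (simp add: k_def \<tau>_def[symmetric] distrib_left right_diff_distrib)
  have G: "2 * \<tau> * G y = b e e + 2 * y * b e w + y\<^sup>2 * b w w" for y
    using \<tau> by (simp add: G_def \<tau>_def[symmetric])
  show mem: "comb e u w 1 x y z \<in> Z \<longleftrightarrow>
      z = k y * x - G y + x * cj y \<and> k y * x + cj (k y * x) = G y + cj (G y)" for x y z
  proof -
    have "b e e + 2 * x * b e u + 2 * y * b e w + 2 * z * \<tau> + 2 * x * y * b u w + y\<^sup>2 * b w w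
        = 2 * \<tau> * (z - (k y * x - G y + x * cj y))"
      using k[of y] G[of y] by algebra
    then have "b e e + 2 * x * b e u + 2 * y * b e w + 2 * z * \<tau> + 2 * x * y * b u w + y\<^sup>2 * b w w = 0
        \<longleftrightarrow> z = k y * x - G y + x * cj y"
      using \<tau> by simp
    moreover have "cj z + z = x * cj y + cj x * y \<longleftrightarrow> k y * x + cj (k y * x) = G y + cj (G y)"
      if "z = k y * x - G y + x * cj y"
    proof -
      have "cj z + z - (x * cj y + cj x * y) = (k y * x + cj (k y * x)) - (G y + cj (G y))"
        unfolding that by simp
      then show ?thesis by (metis right_minus_eq)
    qed
    ultimately show ?thesis
      unfolding comb_mem_Z_iff[OF fr uu] \<tau>_def[symmetric] by auto
  qed
  let ?E = "{(y, x). k y * x + cj (k y * x) = G y + cj (G y)}"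
  have "bij_betw (\<lambda>(y, x). comb e u w 1 x y (k y * x - G y + x * cj y)) ?E Z1"
  proof (rule bij_betw_byWitness[where f' = "\<lambda>v. (- h v u, - h v w)"])
    show "(\<lambda>(y, x). comb e u w 1 x y (k y * x - G y + x * cj y)) ` ?E \<subseteq> Z1"
      using mem by (auto simp: Z1_def frame_coordinates[OF fr] simp del: cj_mult)
    have inv: "(- h v u, - h v w) \<in> ?E \<and>
        (\<lambda>(y, x). comb e u w 1 x y (k y * x - G y + x * cj y)) (- h v u, - h v w) = v"
      if "v \<in> Z1" for v
    proof -
      obtain t x y z where v: "v = comb e u w t x y z" by (rule frame_comb_surj[OF fr])
      have "t = 1" using that frame_coordinates(1)[OF fr] by (simp add: Z1_def v)
      moreover have "v \<in> Z" using that by (simp add: Z1_def)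
      ultimately show ?thesis
        using mem[of x y z] frame_coordinates[OF fr, of t x y z] by (simp add: v)
    qed
    show "(\<lambda>v. (- h v u, - h v w)) ` Z1 \<subseteq> ?E"
      using inv by blast
    show "\<forall>v\<in>Z1. (\<lambda>(y, x). comb e u w 1 x y (k y * x - G y + x * cj y)) (- h v u, - h v w) = v"
      using inv by blast
  qed (auto simp: frame_coordinates[OF fr])
  from bij_betw_same_card[OF this] have "card Z1 = card ?E" by simp
  then show "card Z1 + q * card {y. k y = 0}
      = q ^ 3 + q\<^sup>2 * card {y. k y = 0 \<and> G y + cj (G y) = 0}"
    using card_trace_pencil[of "\<lambda>y. G y + cj (G y)" k] by (simp add: add.commute)
qed

text \<open>At \<open>t = 0\<close> the coordinate \<open>z\<close> drops out of both equations and
  contributes the factor \<open>q\<^sup>2\<close>.\<close>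

lemma card_Z0_eq:
  assumes fr: "frame e u w" and uu: "b u u = 0"
  shows "card Z0 = q\<^sup>2 * card {(x, y). x * cj y + cj x * y = 0 \<and> y * (2 * x * b u w + y * b w w) = 0}"
proof -
  let ?C = "{(x, y). x * cj y + cj x * y = 0 \<and> y * (2 * x * b u w + y * b w w) = 0}"
  have mem: "comb e u w 0 x y z \<in> Z \<longleftrightarrow> (x, y) \<in> ?C" for x y z
    unfolding comb_mem_Z_iff[OF fr uu]
    by (simp add: algebra_simps power2_eq_square eq_commute[of 0])
  have "bij_betw (\<lambda>(z, x, y). comb e u w 0 x y z) (UNIV \<times> ?C) Z0"
  proof (rule bij_betw_byWitness[where f' = "\<lambda>v. (h v e, - h v w, - h v u)"])
    show "(\<lambda>(z, x, y). comb e u w 0 x y z) ` (UNIV \<times> ?C) \<subseteq> Z0"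
      using mem by (auto simp: Z0_def frame_coordinates[OF fr])
    have inv: "(h v e, - h v w, - h v u) \<in> UNIV \<times> ?C \<and> comb e u w 0 (- h v w) (- h v u) (h v e) = v"
      if "v \<in> Z0" for v
    proof -
      obtain t x y z where v: "v = comb e u w t x y z" by (rule frame_comb_surj[OF fr])
      have "t = 0" using that frame_coordinates(1)[OF fr] by (simp add: Z0_def v)
      moreover have "v \<in> Z" using that by (simp add: Z0_def)
      ultimately show ?thesis
        using mem[of x y z] frame_coordinates[OF fr, of t x y z] by (simp add: v)
    qed
    show "(\<lambda>v. (h v e, - h v w, - h v u)) ` Z0 \<subseteq> UNIV \<times> ?C"
      using inv by blast
    show "\<forall>v\<in>Z0. (\<lambda>(z, x, y). comb e u w 0 x y z) (h v e, - h v w, - h v u) = v"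
      using inv by simp
  qed (auto simp: frame_coordinates[OF fr])
  from bij_betw_same_card[OF this] show ?thesis
    by (simp add: card_cartesian_product card_field)
qed

text \<open>All four claims are read off from \<open>extremal_arithmetic\<close>: the first excludes
  a single zero of \<open>k\<close>, the second a single line of common points in the tangent plane,
  and the last two express that \<open>k\<close> has \<open>q\<close> zeros, all meeting the trace
  condition.\<close>

lemma frame_extremal:
  assumes fr: "frame e u w" and uu: "b u u = 0"
  shows "b u w \<noteq> 0"
    and "b w w / b u w + cj (b w w / b u w) = 0"
    and "\<exists>y y'. y \<noteq> y' \<and> b e p * cj y + b u w * y + b e u = 0
      \<and> b e p * cj y' + b u w * y' + b e u = 0"
    and "\<And>x y. b e p * cj y + b u w * y + b e u = 0 \<Longrightarrow> \<exists>z. comb e u w 1 x y z \<in> Z"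
proof -
  define k where "k = (\<lambda>y. - (cj y + b u w / b e p * y + b e u / b e p))"
  define G where "G = (\<lambda>y. (b e e + 2 * y * b e w + y\<^sup>2 * b w w) / (2 * b e p))"
  define Y where "Y = {y. k y = 0}"
  define Y0 where "Y0 = {y. k y = 0 \<and> G y + cj (G y) = 0}"
  define C where "C = {(x, y). x * cj y + cj x * y = 0 \<and> y * (2 * x * b u w + y * b w w) = 0}"
  note aff = card_Z1_eq[OF fr uu, of k G, OF fun_cong[OF k_def] fun_cong[OF G_def]]
  have Z1: "card Z1 + q * card Y = q ^ 3 + q\<^sup>2 * card Y0"
    unfolding Y_def Y0_def by (rule aff(1))
  have Z0: "card Z0 = q\<^sup>2 * card C"
    unfolding C_def by (rule card_Z0_eq[OF fr uu])
  have tot: "(q\<^sup>2 - 1) * card Z1 + q\<^sup>2 * card C = (q\<^sup>2 - 1) * (2 * q ^ 3 + q\<^sup>2) + q\<^sup>2"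
    using card_affine_and_infinite_part unfolding Z0 .
  have sub: "Y0 \<subseteq> Y" by (auto simp: Y_def Y0_def)
  then have Y0Y: "card Y0 \<le> card Y" by (intro card_mono) auto
  have \<tau>: "b e p \<noteq> 0" using frame_gram(20)[OF fr] .
  have kiff: "k y = 0 \<longleftrightarrow> b e p * cj y + b u w * y + b e u = 0" for y
  proof -
    have "b e p * k y = - (b e p * cj y + b u w * y + b e u)"
      using \<tau> by (simp add: k_def distrib_left right_diff_distrib)
    then show ?thesis using \<tau> by (metis mult_eq_0_iff neg_equal_0_iff_equal)
  qed
  have "Y = {y. y ^ q + b u w / b e p * y + b e u / b e p = 0}"
    unfolding Y_def k_def cj_eq neg_equal_0_iff_equal ..
  then have Yq: "card Y \<le> q"
    using card_trinomial_roots_le[of q "b u w / b e p" "b e u / b e p"] q_ge_3 by (simp only:)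
  note ar = extremal_arithmetic[OF q_ge_3 tot Z1 Y0Y Yq]
  show m: "b u w \<noteq> 0"
  proof
    assume m: "b u w = 0"
    \<comment> \<open>Without its linear term, \<open>k\<close> is conjugation up to sign and a
      constant, hence a bijection.\<close>
    have "Y = {cj (- (b e u / b e p))}"
    proof -
      have "y \<in> Y \<longleftrightarrow> cj y = - (b e u / b e p)" for y
        unfolding Y_def k_def m mem_Collect_eq neg_equal_0_iff_equal eq_neg_iff_add_eq_0 by simp
      then have "y \<in> Y \<longleftrightarrow> y = cj (- (b e u / b e p))" for y
        by (metis cj_cj)
      then show ?thesis by blast
    qed
    then have "card Y = 1" by simp
    with ar(1) show False by blast
  qed
  \<comment> \<open>The solutions lie on two lines through the origin of the
    \<open>(x, y)\<close>-plane; counting the origin once gives at most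
    \<open>2 * q\<^sup>2 - 1\<close>.\<close>
  have C_sub: "C \<subseteq> (\<lambda>x. (x, 0)) ` UNIV \<union> (\<lambda>y. (- (b w w / b u w) / 2 * y, y)) ` (UNIV - {0})"
  proof
    fix s assume "s \<in> C"
    then obtain x y where s: "s = (x, y)" and *: "y * (2 * x * b u w + y * b w w) = 0"
      by (auto simp: C_def)
    show "s \<in> (\<lambda>x. (x, 0)) ` UNIV \<union> (\<lambda>y. (- (b w w / b u w) / 2 * y, y)) ` (UNIV - {0})"
    proof (cases "y = 0")
      case False
      with * have x2: "2 * b u w * x = - (y * b w w)" by (simp add: eq_neg_iff_add_eq_0 mult_ac)
      have "x = (2 * b u w * x) / (2 * b u w)" using m by simp
      then have "x = - (y * b w w) / (2 * b u w)" unfolding x2 .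
      then have "x = - (b w w / b u w) / 2 * y" by (simp add: mult.commute)
      with False s show ?thesis by blast
    qed (use s in auto)
  qed
  have inj1: "card ((\<lambda>x::'a. (x, 0::'a)) ` UNIV) = q\<^sup>2"
    by (subst card_image) (auto simp: inj_on_def card_field)
  have "card C \<le> q\<^sup>2 + (q\<^sup>2 - 1)"
  proof -
    have "card C \<le> card ((\<lambda>x::'a. (x, 0::'a)) ` UNIV)
        + card ((\<lambda>y. (- (b w w / b u w) / 2 * y, y)) ` (UNIV - {0}))"
      by (rule order.trans[OF card_mono[OF _ C_sub] card_Un_le]) simp
    also have "\<dots> \<le> q\<^sup>2 + card (UNIV - {0::'a})"
      unfolding inj1 by (intro add_left_mono card_image_le) simp
    finally show ?thesis by (simp add: card_Diff_singleton card_field)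
  qed
  have CZ: "card C = q\<^sup>2" if ne: "b w w / b u w + cj (b w w / b u w) \<noteq> 0"
  proof -
    have "C = (\<lambda>x. (x, 0)) ` UNIV"
    proof
      show "(\<lambda>x. (x, 0)) ` UNIV \<subseteq> C" by (auto simp: C_def)
      have *: False if y: "y \<noteq> 0" and mem: "(- (b w w / b u w) / 2 * y, y) \<in> C" for y
      proof -
        define d where "d = b w w / b u w"
        have "- d / 2 * y * cj y + cj (- d / 2 * y) * y = 0"
          using mem by (simp only: C_def d_def mem_Collect_eq prod.case)
        \<comment> \<open>On the second line the Hermitian condition is the trace of
          \<open>d\<close> times the norm of \<open>y\<close>, up to the factor
          \<open>- 1 / 2\<close>.\<close>
        moreover have "- d / 2 * y * cj y + cj (- d / 2 * y) * y = - (d + cj d) / 2 * (y * cj y)"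
          by (simp add: add_divide_distrib distrib_left distrib_right right_diff_distrib mult_ac)
        ultimately have "d + cj d = 0 \<or> y = 0"
          by (simp only: mult_eq_0_iff divide_eq_0_iff neg_equal_0_iff_equal two_neq_0 cj_eq_0_iff) blast
        with ne y show False unfolding d_def by blast
      qed
      show "C \<subseteq> (\<lambda>x. (x, 0)) ` UNIV"
      proof
        fix s assume s: "s \<in> C"
        from subsetD[OF C_sub s] show "s \<in> (\<lambda>x. (x, 0)) ` UNIV"
        proof
          assume "s \<in> (\<lambda>y. (- (b w w / b u w) / 2 * y, y)) ` (UNIV - {0})"
          then obtain y where y: "s = (- (b w w / b u w) / 2 * y, y)" "y \<in> UNIV - {0}"
            by (rule imageE)
          from y(2) have "y \<noteq> 0" by simp
          from *[OF this s[unfolded y(1)]] show ?thesis by (rule FalseE)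
        qed
      qed
    qed
    then show ?thesis using inj1 by simp
  qed
  show tr: "b w w / b u w + cj (b w w / b u w) = 0"
    using CZ ar(2) by blast
  have "card Y0 = q" "card Y = q"
    using ar(3) \<open>card C \<le> q\<^sup>2 + (q\<^sup>2 - 1)\<close> by blast+
  then have "Y0 = Y" using sub by (intro card_subset_eq) auto
  show "\<exists>y y'. y \<noteq> y' \<and> b e p * cj y + b u w * y + b e u = 0
      \<and> b e p * cj y' + b u w * y' + b e u = 0"
  proof -
    have "\<not> card Y \<le> 1" using \<open>card Y = q\<close> q_ge_3 by simp
    then obtain y y' where "y \<in> Y" "y' \<in> Y" "y \<noteq> y'"
      by (metis One_nat_def card_le_Suc0_iff_eq finite)
    then show ?thesis by (auto simp: Y_def kiff)
  qed
  \<comment> \<open>At a zero of \<open>k\<close> the trace equation does not involve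
    \<open>x\<close>, so every \<open>x\<close> occurs.\<close>
  show "\<exists>z. comb e u w 1 x y z \<in> Z" if "b e p * cj y + b u w * y + b e u = 0" for x y
  proof -
    have "y \<in> Y0" using that \<open>Y0 = Y\<close> by (simp add: Y_def kiff)
    then have "comb e u w 1 x y (k y * x - G y + x * cj y) \<in> Z"
      unfolding aff(2) by (simp add: Y0_def)
    then show ?thesis by blast
  qed
qed

text \<open>Once \<open>b w w = 0\<close>, the roles of \<open>u\<close> and \<open>w\<close> are
  symmetric. A zero \<open>y\<close> of \<open>k\<close> and a zero \<open>x\<close> of its analogue
  for the swapped frame give a common zero \<open>E\<close>; one and the same multiple of
  \<open>p\<close>, added to \<open>u\<close>, makes it orthogonal to \<open>E\<close> under both
  forms, and likewise for \<open>w\<close>.\<close>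

lemma exists_normal_frame:
  obtains e u w where "frame e u w" "b e e = 0" "b u u = 0" "b w w = 0" "b e u = 0" "b e w = 0"
    "b u w = - b e p"
proof -
  obtain e u w0 where fr0: "frame e u w0" and uu: "b u u = 0" by (rule exists_frame)
  \<comment> \<open>This \<open>c\<close> has trace zero, so adding \<open>c *s u\<close> to
    \<open>w0\<close> removes \<open>b w0 w0\<close> and keeps the vector isotropic for
    \<open>h\<close>.\<close>
  define c where "c = - (b w0 w0 / b u w0) / 2"
  have c: "cj c = - c"
  proof -
    have "c + cj c = - (b w0 w0 / b u w0 + cj (b w0 w0 / b u w0)) / 2"
      by (simp add: c_def add_divide_distrib)
    then have "cj c + c = 0" unfolding frame_extremal(2)[OF fr0 uu] by (simp add: add.commute)
    then show ?thesis by (simp only: eq_neg_iff_add_eq_0)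
  qed
  define w where "w = w0 + c *s u"
  have fr: "frame e u w"
    by (simp add: frame_def w_def form_simps frame_gram[OF fr0] c)
  have "2 * (c * b u w0) = - b w0 w0"
    using frame_extremal(1)[OF fr0 uu] by (simp add: c_def)
  moreover have "b w w = b w0 w0 + (c * b u w0 + c * b u w0)"
    by (simp add: w_def form_simps uu b_sym[of w0 u])
  ultimately have "b w w = 0" by (simp only: mult_2 right_minus)
  obtain y y' where y: "y \<noteq> y'" "b e p * cj y + b u w * y + b e u = 0"
    "b e p * cj y' + b u w * y' + b e u = 0"
    using frame_extremal(3)[OF fr uu] by blast
  obtain x where x: "b e p * cj x + b u w * x + b e w = 0"
    using frame_extremal(3)[OF frame_swap[OF fr] \<open>b w w = 0\<close>] b_sym[of w u] by auto
  obtain z where z: "comb e u w 1 x y z \<in> Z"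
    using frame_extremal(4)[OF fr uu y(2)] by blast
  \<comment> \<open>A difference of two zeros of \<open>k\<close> solves the homogeneous equation,
    which fixes the ratio of \<open>r\<close> to \<open>cj r\<close>.\<close>
  define r where "r = y - y'"
  have r: "r \<noteq> 0" "b e p * cj r = - (b u w * r)"
  proof -
    have "b e p * cj r + b u w * r
      = (b e p * cj y + b u w * y + b e u) - (b e p * cj y' + b u w * y' + b e u)"
      by (simp add: r_def algebra_simps)
    then show "b e p * cj r = - (b u w * r)" by (simp only: y eq_neg_iff_add_eq_0 diff_self)
    show "r \<noteq> 0" using y(1) by (simp add: r_def)
  qed
  \<comment> \<open>The scalars \<open>1 / cj r\<close> and \<open>r\<close> preserve
    \<open>h U W = - 1\<close> and multiply \<open>b u w\<close> by \<open>r / cj r\<close>, which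
    turns it into \<open>- b e p\<close>.\<close>
  define E U W where "E = comb e u w 1 x y z" and "U = (1 / cj r) *s (u + cj y *s p)"
    and "W = r *s (w + cj x *s p)"
  note [simp] = frame_gram[OF fr] h_p_p b_p_p uu \<open>b w w = 0\<close>
  have E: "h E E = 0" "b E E = 0" "h E p = 1" "h E u = - y" "h E w = - x" "b E p = b e p"
    "b E u = b e u + y * b u w" "b E w = b e w + x * b u w"
    using z b_sym[of w u] by (simp_all add: E_def Z_def comb_def form_simps)
  have "frame E U W"
    using r(1) by (simp add: frame_def E U_def W_def form_simps)
  moreover have "b U U = 0" "b W W = 0"
    by (simp_all add: U_def W_def form_simps)
  moreover have "b E U = 0"
  proof -
    have "b E u + cj y * b E p = 0" using y(2) by (simp add: E algebra_simps)
    then show ?thesis by (simp only: U_def form_simps mult_zero_right)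
  qed
  moreover have "b E W = 0"
  proof -
    have "b E w + cj x * b E p = 0" using x by (simp add: E algebra_simps)
    then show ?thesis by (simp only: W_def form_simps mult_zero_right)
  qed
  moreover have "b U W = - b E p"
    using r by (simp add: U_def W_def form_simps E field_simps)
  ultimately show ?thesis using that E(2) by blast
qed

end

section \<open>Points, lines and the normal form\<close>

text \<open>In the index type \<open>4 = 0\<close>, so \<open>i + j = 1\<close> holds for the index pairs \<open>{1, 4}\<close> and \<open>{2, 3}\<close>.\<close>

definition hyp_matrix :: "'a::field ^ 4 ^ 4" where
  "hyp_matrix = (\<chi> i j. if i + j = 1 then (if i = 1 \<or> j = 1 then 1 else - 1) else 0)"

lemma quad_bilin_hyp_matrix:
  "quad_bilin hyp_matrix s t = s $ 1 * t $ 4 + s $ 4 * t $ 1 - s $ 2 * t $ 3 - s $ 3 * t $ 2"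
  by (simp add: quad_bilin_def hyp_matrix_def sum_4)

lemma vec4_eqI: "x $ 1 = y $ 1 \<Longrightarrow> x $ 2 = y $ 2 \<Longrightarrow> x $ 3 = y $ 3 \<Longrightarrow> x $ 4 = y $ 4 \<Longrightarrow> x = y"
  for x :: "'a ^ 4"
  by (simp add: vec_eq_iff forall_4)

lemma transpose_hyp_matrix: "transpose hyp_matrix = hyp_matrix"
  by (auto simp: transpose_def hyp_matrix_def vec_eq_iff add.commute)

section \<open>Points and lines as spans of vectors\<close>

lemma pg_points_iff:
  "P \<in> pg_points \<longleftrightarrow> (\<exists>x. x \<noteq> 0 \<and> P = vec.span {x})" for P :: "('a::field ^ 4) set"
proof
  assume P: "P \<in> pg_points"
  obtain B where B: "B \<subseteq> P" "vec.independent B" "P \<subseteq> vec.span B" "card B = vec.dim P"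
    by (rule vec.basis_exists)
  with P obtain x where x: "B = {x}" by (auto simp: pg_points_def card_1_singleton_iff)
  have "P = vec.span {x}"
    using B P x vec.span_minimal[of B P] by (auto simp: pg_points_def)
  moreover have "x \<noteq> 0" using B(2) x by auto
  ultimately show "\<exists>x. x \<noteq> 0 \<and> P = vec.span {x}" by blast
next
  assume "\<exists>x. x \<noteq> 0 \<and> P = vec.span {x}"
  then obtain x where "x \<noteq> 0" "P = vec.span {x}" by blast
  then show "P \<in> pg_points"
    by (simp add: pg_points_def vec.dim_eq_card_independent)
qed

lemma mem_span_pair_iff: "v \<in> vec.span {x, y} \<longleftrightarrow> (\<exists>c d. v = c *s x + d *s y)"
  for v :: "'a::field ^ 4"
  unfolding vec.span_insert vec.span_empty
  by (auto simp: algebra_simps diff_eq_eq)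

lemma span_pair_mem_pg_lines:
  fixes x y :: "'a::field ^ 4"
  assumes "\<And>c d. c *s x + d *s y = 0 \<Longrightarrow> c = 0 \<and> d = 0"
  shows "vec.span {x, y} \<in> pg_lines"
proof -
  have "y \<noteq> 0" using assms[of 0 1] by auto
  have "x \<notin> vec.span {y}"
  proof
    assume "x \<in> vec.span {y}"
    then obtain k where "x = k *s y" by (auto simp: vec.span_singleton)
    then have "1 *s x + (- k) *s y = 0" by (simp add: vec.scale_minus_left)
    from assms[OF this] show False by simp
  qed
  then have "x \<noteq> y" using vec.span_base[of y "{y}"] by blast
  have "vec.independent {x, y}"
    using \<open>x \<notin> vec.span {y}\<close> \<open>x \<noteq> y\<close> \<open>y \<noteq> 0\<close> by (simp add: vec.independent_insert)
  then show ?thesis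
    using \<open>x \<noteq> y\<close> by (simp add: pg_lines_def vec.dim_eq_card_independent)
qed

lemma span_singleton_scale:
  fixes x :: "'a::field ^ 4"
  assumes "c \<noteq> 0"
  shows "vec.span {c *s x} = vec.span {x}"
proof -
  have "k *s x \<in> range (\<lambda>k. k *s (c *s x))" for k
    by (rule range_eqI[of _ _ "k / c"]) (use assms in simp)
  then show ?thesis by (auto simp: vec.span_singleton)
qed

text \<open>The points partition the nonzero vectors of a cone, with \<open>CARD('a) - 1\<close> of
  them on each point.\<close>

lemma card_cone_eq_points:
  fixes V :: "('a::{field,finite} ^ 4) set"
  assumes scale: "\<And>c v. v \<in> V \<Longrightarrow> c *s v \<in> V" and "0 \<in> V"
  shows "card V = (CARD('a) - 1) * card {P \<in> pg_points. P \<subseteq> V} + 1"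
proof -
  let ?L = "{P \<in> pg_points. P \<subseteq> V}"
  have "V - {0} = (\<Union>P\<in>?L. P - {0})"
  proof (intro equalityI subsetI)
    fix v assume v: "v \<in> V - {0}"
    then have "vec.span {v} \<in> ?L"
      using scale pg_points_iff by (auto simp: vec.span_singleton)
    moreover have "v \<in> vec.span {v}" by (simp add: vec.span_base)
    ultimately show "v \<in> (\<Union>P\<in>?L. P - {0})" using v by blast
  qed auto
  moreover have "card (\<Union>P\<in>?L. P - {0}) = (\<Sum>P\<in>?L. card (P - {0}))"
  proof (rule card_UN_disjoint)
    show "\<forall>P\<in>?L. \<forall>P'\<in>?L. P \<noteq> P' \<longrightarrow> (P - {0}) \<inter> (P' - {0}) = {}"
    proof (intro ballI impI, rule ccontr)
      fix P P' assume "P \<in> ?L" "P' \<in> ?L" "P \<noteq> P'" "(P - {0}) \<inter> (P' - {0}) \<noteq> {}"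
      then obtain v where v: "v \<in> P" "v \<in> P'" "v \<noteq> 0" by blast
      have "R = vec.span {v}" if R: "R \<in> pg_points" "v \<in> R" for R
      proof -
        obtain x where x: "R = vec.span {x}" using pg_points_iff[THEN iffD1, OF R(1)] by auto
        with R(2) obtain c where c: "v = c *s x" by (auto simp: vec.span_singleton)
        then have "c \<noteq> 0" using v(3) by auto
        then show ?thesis unfolding x c by (rule span_singleton_scale[symmetric])
      qed
      with v \<open>P \<in> ?L\<close> \<open>P' \<in> ?L\<close> have "P = P'" by blast
      with \<open>P \<noteq> P'\<close> show False by blast
    qed
  qed auto
  moreover have "card (P - {0}) = CARD('a) - 1" if P: "P \<in> ?L" for P
  proof -
    from P have "P \<in> pg_points" by simp
    from pg_points_iff[THEN iffD1, OF this] obtain x where x: "x \<noteq> 0" "P = vec.span {x}" by blast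
    have "card (range (\<lambda>c. c *s x)) = CARD('a)"
      using x(1) by (intro card_image) (auto intro!: injI)
    moreover have "0 \<in> P" using x(2) vec.span_zero by blast
    ultimately show ?thesis using x(2) by (simp add: vec.span_singleton card_Diff_singleton)
  qed
  ultimately have "card (V - {0}) = (CARD('a) - 1) * card ?L"
    by (simp add: mult.commute)
  then show ?thesis using \<open>0 \<in> V\<close> card_Suc_Diff1[of V 0] by simp
qed

definition vec4 :: "'a \<Rightarrow> 'a \<Rightarrow> 'a \<Rightarrow> 'a \<Rightarrow> 'a ^ 4" where
  "vec4 t x y z = (\<chi> i. if i = 1 then t else if i = 2 then x else if i = 3 then y else z)"

lemma vec4_nth [simp]:
  "vec4 t x y z $ 1 = t" "vec4 t x y z $ 2 = x" "vec4 t x y z $ 3 = y" "vec4 t x y z $ 4 = z"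
  by (simp_all add: vec4_def)

lemma quad_bilin_eq: "quad_bilin A x y = (\<Sum>i\<in>UNIV. x $ i * (A *v y) $ i)"
  by (simp add: quad_bilin_def matrix_vector_mult_def sum_distrib_left mult_ac)

text \<open>At the places \<open>i\<close> and \<open>j\<close> the two vectors form a triangular
  matrix with unit diagonal.\<close>

lemma vec4_independent:
  fixes a d :: "'a::field ^ 4"
  assumes "a $ i = 1" "d $ i = 0" "d $ j = 1" "x *s a + y *s d = 0"
  shows "x = 0 \<and> y = 0"
proof -
  have *: "x * a $ k + y * d $ k = 0" for k
    using arg_cong[OF assms(4), of "\<lambda>v. v $ k"] by simp
  have "x = 0" using *[of i] assms by simp
  moreover have "y = 0" using *[of j] assms \<open>x = 0\<close> by simp
  ultimately show ?thesis by blast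
qed

text \<open>The columns of \<open>M\<close> are the vectors \<open>e, u, w, p\<close> of a normal
  frame; up to the factor \<open>c\<close> both forms then have the same Gram matrix.\<close>

lemma (in tangent_forms) exists_normal_coordinates:
  obtains M c where "invertible M" "c \<noteq> 0"
    "\<And>s t. h (M *v s) (M *v t) = quad_bilin hyp_matrix s (\<chi> i. cj (t $ i))"
    "\<And>s t. b (M *v s) (M *v t) = c * quad_bilin hyp_matrix s t"
proof -
  obtain e u w where fr: "frame e u w" and b: "b e e = 0" "b u u = 0" "b w w = 0" "b e u = 0"
    "b e w = 0" "b u w = - b e p"
    by (rule exists_normal_frame)
  define M :: "'a ^ 4 ^ 4" where
    "M = (\<chi> i j. if j = 1 then e $ i else if j = 2 then u $ i else if j = 3 then w $ i else p $ i)"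
  have M: "M *v s = comb e u w (s $ 1) (s $ 2) (s $ 3) (s $ 4)" for s
    by (simp add: M_def vec_eq_iff matrix_vector_mult_def sum_4 comb_def mult.commute)
  have "s = 0" if "M *v s = 0" for s
  proof -
    have "comb e u w (s $ 1) (s $ 2) (s $ 3) (s $ 4) = 0" using that M by simp
    with frame_coordinates[OF fr, of "s $ 1" "s $ 2" "s $ 3" "s $ 4"] show ?thesis
      by (intro vec4_eqI) simp_all
  qed
  then have "invertible M"
    by (simp add: invertible_left_inverse matrix_left_invertible_ker)
  moreover have "h (M *v s) (M *v t) = quad_bilin hyp_matrix s (\<chi> i. cj (t $ i))" for s t
    unfolding M quad_bilin_hyp_matrix
    by (simp add: comb_def form_simps frame_gram[OF fr] h_p_p algebra_simps)
  moreover have "b (M *v s) (M *v t) = b e p * quad_bilin hyp_matrix s t" for s t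
  proof -
    have bs: "b p e = b e p" "b u e = 0" "b w e = 0" "b w u = - b e p"
      using b b_sym[of p e] b_sym[of u e] b_sym[of w e] b_sym[of w u] by simp_all
    show ?thesis
      unfolding M quad_bilin_hyp_matrix
      by (simp add: comb_def form_simps frame_gram[OF fr] b bs b_p_p algebra_simps)
  qed
  ultimately show ?thesis using that frame_gram(20)[OF fr] by blast
qed

section \<open>Geometry of the two surfaces in normal coordinates\<close>

locale normal_position = square_order_field q cj for q and cj :: "'a::{field,finite} \<Rightarrow> 'a" +
  fixes H A M :: "'a ^ 4 ^ 4" and c :: 'a
  assumes M_invertible: "invertible M" and c_neq_0: "c \<noteq> 0"
    and herm_form_M: "\<And>s t. herm_form q H (M *v s) (M *v t)
      = quad_bilin hyp_matrix s (\<chi> i. cj (t $ i))"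
    and quad_bilin_M: "\<And>s t. quad_bilin A (M *v s) (M *v t) = c * quad_bilin hyp_matrix s t"
begin

lemma M_eq_0_iff [simp]: "M *v s = 0 \<longleftrightarrow> s = 0"
  using M_invertible matrix_left_invertible_ker[of M] invertible_left_inverse[of M]
  by (auto simp: matrix_vector_mult_0_right)

lemma M_surj: obtains s where "v = M *v s"
  using M_invertible matrix_right_invertible_surjective[of M] invertible_right_inverse[of M]
  by (metis surjD)

abbreviation \<beta> :: "'a ^ 4 \<Rightarrow> 'a ^ 4 \<Rightarrow> 'a" where
  "\<beta> \<equiv> quad_bilin hyp_matrix"

abbreviation cjv :: "'a ^ 4 \<Rightarrow> 'a ^ 4" where
  "cjv t \<equiv> \<chi> i. cj (t $ i)"

lemma \<beta>_sym: "\<beta> s t = \<beta> t s"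
  by (simp add: quad_bilin_hyp_matrix algebra_simps)

lemma \<beta>_cjv: "\<beta> (cjv s) (cjv t) = cj (\<beta> s t)"
  by (simp add: quad_bilin_hyp_matrix)

lemma cjv_cjv: "cjv (cjv t) = t"
  by (simp add: vec_eq_iff)

text \<open>The matrix of \<open>\<beta>\<close> is fixed by conjugation, so \<open>cjv\<close>,
  applied to coordinates, interchanges the two polars of any \<open>U\<close>. Each inclusion
  evaluates its hypothesis at the conjugate of the vector to be tested.\<close>

lemma permutable: "permutable_position q H A"
  unfolding permutable_position_def
proof (intro allI impI equalityI subsetI)
  fix U y
  obtain t where y: "y = M *v t" by (rule M_surj)
  {
    assume L: "y \<in> quad_polar A (herm_polar q H U)"
    have "herm_form q H y x = 0" if x: "\<forall>u\<in>U. quad_bilin A u x = 0" for x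
    proof -
      obtain s where s: "x = M *v s" by (rule M_surj)
      have "herm_form q H (M *v cjv s) u = 0" if u: "u \<in> U" for u
      proof -
        obtain r where r: "u = M *v r" by (rule M_surj)
        have "\<beta> r s = 0" using x u c_neq_0 by (auto simp: r s quad_bilin_M)
        then show ?thesis unfolding r herm_form_M \<beta>_cjv by (simp add: \<beta>_sym[of s r])
      qed
      then have "quad_bilin A (M *v cjv s) y = 0" using L by (auto simp: quad_polar_def herm_polar_def)
      then have "\<beta> (cjv s) t = 0" using c_neq_0 by (simp add: y quad_bilin_M)
      then show ?thesis unfolding y s herm_form_M by (simp add: \<beta>_sym[of t])
    qed
    then show "y \<in> herm_polar q H (quad_polar A U)"
      by (auto simp: quad_polar_def herm_polar_def)
  next
    assume R: "y \<in> herm_polar q H (quad_polar A U)"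
    have "quad_bilin A x y = 0" if x: "\<forall>u\<in>U. herm_form q H x u = 0" for x
    proof -
      obtain s where s: "x = M *v s" by (rule M_surj)
      have "quad_bilin A u (M *v cjv s) = 0" if u: "u \<in> U" for u
      proof -
        obtain r where r: "u = M *v r" by (rule M_surj)
        have "\<beta> s (cjv r) = 0" using x u by (auto simp: r s herm_form_M)
        then have "cj (\<beta> (cjv s) r) = 0" using \<beta>_cjv[of "cjv s" r] by (simp only: cjv_cjv)
        then show ?thesis unfolding r quad_bilin_M by (simp add: \<beta>_sym[of r])
      qed
      then have "herm_form q H y (M *v cjv s) = 0" using R by (auto simp: quad_polar_def herm_polar_def)
      then have "\<beta> t s = 0" unfolding y herm_form_M cjv_cjv .
      then show ?thesis unfolding y s quad_bilin_M by (simp add: \<beta>_sym[of s])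
    qed
    then show "y \<in> quad_polar A (herm_polar q H U)"
      by (auto simp: quad_polar_def herm_polar_def)
  }
qed

definition S :: "('a ^ 4) set set" where
  "S = framed_subgeometry q M"

text \<open>In coordinates over the subfield this is the quadric
  \<open>t * z = x * y\<close>.\<close>

definition Q' :: "('a ^ 4) set set" where
  "Q' = {vec.span {M *v t} |t. t \<in> subfield_vecs q \<and> t \<noteq> 0 \<and> \<beta> t t = 0}"

lemma baer_quadric: "baer_quadric q S Q'"
  unfolding baer_quadric_def
proof (intro exI conjI)
  show "transpose hyp_matrix = hyp_matrix" by (rule transpose_hyp_matrix)
  show "hyp_matrix \<noteq> (0 :: 'a ^ 4 ^ 4)"
    by (auto simp: vec_eq_iff forall_4 hyp_matrix_def)
  show "\<forall>i j. (hyp_matrix $ i $ j :: 'a) ^ q = hyp_matrix $ i $ j"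
    by (auto simp: hyp_matrix_def simp flip: cj_eq)
qed (rule M_invertible S_def Q'_def)+

lemma \<beta>_comb: "\<beta> (x *s a + y *s d) (x *s a + y *s d) = x\<^sup>2 * \<beta> a a + 2 * x * y * \<beta> a d + y\<^sup>2 * \<beta> d d"
  by (simp add: quad_bilin_hyp_matrix power2_eq_square algebra_simps)

lemma M_comb: "x *s (M *v a) + y *s (M *v d) = M *v (x *s a + y *s d)"
  by (simp add: matrix_vector_right_distrib vector_scalar_commute)

lemma mem_quadricI:
  assumes "P \<in> pg_points" "P \<subseteq> vec.span {M *v a, M *v d}" "\<beta> a a = 0" "\<beta> a d = 0" "\<beta> d d = 0"
  shows "P \<in> quadric A"
proof -
  have "quad_bilin A v v = 0" if "v \<in> vec.span {M *v a, M *v d}" for v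
    using that assms(3-5) by (auto simp: mem_span_pair_iff M_comb quad_bilin_M \<beta>_comb)
  with assms(1,2) show ?thesis by (auto simp: quadric_def)
qed

text \<open>The points of \<open>M *v a\<close> and \<open>M *v d\<close> lie in \<open>S\<close>,
  so the line meets \<open>S\<close> in a line of the subgeometry. As \<open>\<beta>\<close>
  vanishes on the span of \<open>a\<close> and \<open>d\<close>, every point of this intersection is
  in \<open>Q'\<close>.\<close>

lemma extended_generatorI:
  assumes a: "a \<in> subfield_vecs q" and d: "d \<in> subfield_vecs q"
    and ind: "\<And>x y. x *s a + y *s d = 0 \<Longrightarrow> x = 0 \<and> y = 0"
    and \<beta>: "\<beta> a a = 0" "\<beta> a d = 0" "\<beta> d d = 0"
  shows "vec.span {M *v a, M *v d} \<in> extended_generators S Q'"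
proof -
  let ?l = "vec.span {M *v a, M *v d}"
  have line: "?l \<in> pg_lines"
    by (rule span_pair_mem_pg_lines) (use ind in \<open>simp add: M_comb\<close>)
  have nz: "a \<noteq> 0" "d \<noteq> 0" using ind[of 1 0] ind[of 0 1] by auto
  have pts: "{vec.span {M *v a}, vec.span {M *v d}} \<subseteq> points_on ?l \<inter> S"
  proof -
    have "vec.span {M *v t} \<in> points_on ?l \<inter> S" if "t \<in> {a, d}" for t
    proof -
      have "vec.span {M *v t} \<subseteq> ?l" using that by (intro vec.span_mono) auto
      moreover have "t \<noteq> 0" using that nz by auto
      then have "vec.span {M *v t} \<in> pg_points"
        unfolding pg_points_iff by (intro exI[of _ "M *v t"]) simp
      moreover have "vec.span {M *v t} \<in> S"
        using that nz a d by (auto simp: S_def framed_subgeometry_def)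
      ultimately show ?thesis by (simp add: points_on_def)
    qed
    then show ?thesis by blast
  qed
  have ne: "vec.span {M *v a} \<noteq> vec.span {M *v d}"
  proof
    assume "vec.span {M *v a} = vec.span {M *v d}"
    then have "M *v a \<in> vec.span {M *v d}" using vec.span_base[of "M *v a" "{M *v a}"] by simp
    then obtain k where "M *v a = k *s (M *v d)" by (auto simp: vec.span_singleton)
    then have "1 *s (M *v a) + (- k) *s (M *v d) = 0" by (simp add: vec.scale_minus_left)
    then have "1 *s a + (- k) *s d = 0" unfolding M_comb by simp
    from ind[OF this] show False by simp
  qed
  have "2 \<le> card (points_on ?l \<inter> S)"
    using card_mono[OF _ pts] ne by simp
  then have "points_on ?l \<inter> S \<in> baer_lines S"
    using line by (auto simp: baer_lines_def)
  moreover have "points_on ?l \<inter> S \<subseteq> Q'"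
  proof
    fix P assume P: "P \<in> points_on ?l \<inter> S"
    then obtain t where t: "P = vec.span {M *v t}" "t \<in> subfield_vecs q" "t \<noteq> 0"
      by (auto simp: S_def framed_subgeometry_def)
    have "M *v t \<in> ?l" using P t(1) vec.span_base[of "M *v t" "{M *v t}"] by (auto simp: points_on_def)
    then obtain x y where "M *v t = M *v (x *s a + y *s d)"
      by (auto simp: mem_span_pair_iff M_comb)
    then have "M *v (t - (x *s a + y *s d)) = 0" by (simp add: matrix_vector_mult_diff_distrib)
    then have "t = x *s a + y *s d" by simp
    then have "\<beta> t t = 0" using \<beta> by (simp add: \<beta>_comb)
    with t show "P \<in> Q'" by (auto simp: Q'_def)
  qed
  ultimately show ?thesis
    using line by (auto simp: extended_generators_def baer_generators_def)
qed

text \<open>A vector in the kernel of \<open>A\<close> is orthogonal to everything under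
  \<open>\<beta>\<close>, and pairing with the unit vectors shows that its coordinates
  vanish.\<close>

lemma det_neq_0: "det A \<noteq> 0"
proof -
  have "x = 0" if "A *v x = 0" for x
  proof -
    obtain s where s: "x = M *v s" by (rule M_surj)
    have "\<beta> t s = 0" for t
    proof -
      have "quad_bilin A (M *v t) x = 0" using that by (simp add: quad_bilin_eq)
      then show ?thesis using c_neq_0 by (simp add: s quad_bilin_M)
    qed
    from this[of "vec4 1 0 0 0"] this[of "vec4 0 1 0 0"] this[of "vec4 0 0 1 0"]
      this[of "vec4 0 0 0 1"]
    have "s = 0" by (intro vec4_eqI) (simp_all add: quad_bilin_hyp_matrix)
    then show ?thesis using s by simp
  qed
  then have "invertible A"
    by (simp add: invertible_left_inverse matrix_left_invertible_ker)
  then show ?thesis by (simp add: invertible_det_nz)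
qed

text \<open>The line \<open>t = x = 0\<close> lies on the quadric.\<close>

lemma hyperbolic:
  assumes "transpose A = A"
  shows "hyperbolic_quadric A"
proof -
  let ?a = "vec4 0 0 1 0 :: 'a ^ 4" and ?d = "vec4 0 0 0 1 :: 'a ^ 4"
  have "vec.span {M *v ?a, M *v ?d} \<in> pg_lines"
  proof (rule span_pair_mem_pg_lines)
    fix x y assume "x *s (M *v ?a) + y *s (M *v ?d) = 0"
    then have "x *s ?a + y *s ?d = 0" by (simp only: M_comb M_eq_0_iff)
    then show "x = 0 \<and> y = 0" by (rule vec4_independent[of _ 3 _ 4, rotated 3]) simp_all
  qed
  moreover have "points_on (vec.span {M *v ?a, M *v ?d}) \<subseteq> quadric A"
    by (auto simp: points_on_def quad_bilin_hyp_matrix intro: mem_quadricI)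
  ultimately show ?thesis
    using assms det_neq_0 by (auto simp: hyperbolic_quadric_def)
qed

text \<open>When the coordinates \<open>t\<close> lie in the subfield, both forms take multiples of
  \<open>\<beta> t t\<close> on all scalar multiples of \<open>M *v t\<close>.\<close>

lemma Q'_subset: "Q' \<subseteq> hermitian_surface q H \<inter> quadric A"
proof
  fix P assume "P \<in> Q'"
  then obtain t where t: "P = vec.span {M *v t}" "t \<in> subfield_vecs q" "t \<noteq> 0" "\<beta> t t = 0"
    by (auto simp: Q'_def)
  have P: "P \<in> pg_points"
    unfolding pg_points_iff t(1) using t(3) by (intro exI[of _ "M *v t"]) simp
  have real: "cj (t $ i) = t $ i" for i using t(2) by (simp add: subfield_vecs_def cj_eq)
  have "herm_form q H v v = 0 \<and> quad_bilin A v v = 0" if "v \<in> P" for v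
  proof -
    from that t(1) obtain k where "v = k *s (M *v t)" by (auto simp: vec.span_singleton)
    then have v: "v = M *v (k *s t)" by (simp add: vector_scalar_commute)
    have "\<beta> (k *s t) (cjv (k *s t)) = k * cj k * \<beta> t t"
      by (simp add: quad_bilin_hyp_matrix real algebra_simps)
    moreover have "\<beta> (k *s t) (k *s t) = k * k * \<beta> t t"
      by (simp add: quad_bilin_hyp_matrix algebra_simps)
    ultimately show ?thesis
      unfolding v herm_form_M quad_bilin_M using t(4) by simp
  qed
  with P show "P \<in> hermitian_surface q H \<inter> quadric A"
    by (simp add: hermitian_surface_def quadric_def)
qed

lemma vec4_mem_subfield_vecs:
  assumes "cj t = t" "cj x = x" "cj y = y" "cj z = z"
  shows "vec4 t x y z \<in> subfield_vecs q"
  using assms by (simp add: subfield_vecs_def forall_4 cj_eq)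

text \<open>With first coordinate 0 the quadric reduces to \<open>x * y = 0\<close>, two lines
  spanned over the subfield. With first coordinate 1 it gives \<open>z = x * y\<close>, and the
  Hermitian equation factors, so that \<open>x\<close> or \<open>y\<close> lies in the
  subfield.\<close>

lemma exists_extended_generator:
  assumes s1: "s $ 1 = 0 \<or> s $ 1 = 1" and "\<beta> s s = 0" "\<beta> s (cjv s) = 0"
  shows "\<exists>l\<in>extended_generators S Q'. M *v s \<in> l"
proof -
  have quad: "s $ 1 * s $ 4 = s $ 2 * s $ 3"
  proof -
    have "2 * (s $ 1 * s $ 4 - s $ 2 * s $ 3) = 0"
      using assms(2) by (simp add: quad_bilin_hyp_matrix algebra_simps)
    then show ?thesis by (simp del: mult_eq_0_iff add: mult_eq_0_iff[of 2])
  qed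
  have gen: ?thesis
    if "a \<in> subfield_vecs q" "d \<in> subfield_vecs q" "a $ i = 1" "d $ i = 0" "d $ j = 1"
      "\<beta> a a = 0" "\<beta> a d = 0" "\<beta> d d = 0" "s = x *s a + y *s d" for a d i j x y
  proof
    show "M *v s \<in> vec.span {M *v a, M *v d}"
      unfolding mem_span_pair_iff using that(9) M_comb by metis
    show "vec.span {M *v a, M *v d} \<in> extended_generators S Q'"
      using that vec4_independent[OF that(3-5)] by (intro extended_generatorI) auto
  qed
  show ?thesis
  proof (cases "s $ 1 = 0")
    case True
    with quad have "s $ 2 = 0 \<or> s $ 3 = 0" by simp
    then show ?thesis
    proof
      assume "s $ 2 = 0"
      then have "s = (s $ 3) *s vec4 0 0 1 0 + (s $ 4) *s vec4 0 0 0 1"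
        using True by (intro vec4_eqI) simp_all
      then show ?thesis
        by (rule gen[of "vec4 0 0 1 0" "vec4 0 0 0 1" 3 4, rotated 8])
          (simp_all add: vec4_mem_subfield_vecs quad_bilin_hyp_matrix)
    next
      assume "s $ 3 = 0"
      then have "s = (s $ 2) *s vec4 0 1 0 0 + (s $ 4) *s vec4 0 0 0 1"
        using True by (intro vec4_eqI) simp_all
      then show ?thesis
        by (rule gen[of "vec4 0 1 0 0" "vec4 0 0 0 1" 2 4, rotated 8])
          (simp_all add: vec4_mem_subfield_vecs quad_bilin_hyp_matrix)
    qed
  next
    case False
    with s1 have 1: "s $ 1 = 1" by blast
    define x y where "x = s $ 2" and "y = s $ 3"
    have 4: "s $ 4 = x * y" using quad 1 by (simp add: x_def y_def)
    have "(x - cj x) * (y - cj y) = \<beta> s (cjv s)"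
      by (simp add: quad_bilin_hyp_matrix 1 4 flip: x_def y_def) (simp add: algebra_simps)
    then have "(x - cj x) * (y - cj y) = 0" by (simp only: assms(3))
    then have "cj x = x \<or> cj y = y" by auto
    then show ?thesis
    proof
      assume "cj x = x"
      \<comment> \<open>For fixed \<open>x\<close> the vectors \<open>(1, x, y, x * y)\<close> run
        along one generator, spanned over the subfield since \<open>x\<close> lies in it; the other
        case uses the opposite family.\<close>
      moreover have "s = 1 *s vec4 1 x 0 0 + y *s vec4 0 0 1 x"
        using 1 4 by (intro vec4_eqI) (simp_all add: x_def y_def mult.commute)
      ultimately show ?thesis
        by (intro gen[of "vec4 1 x 0 0" "vec4 0 0 1 x" 1 3 1 y])
          (simp_all add: vec4_mem_subfield_vecs quad_bilin_hyp_matrix)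
    next
      assume "cj y = y"
      moreover have "s = 1 *s vec4 1 0 y 0 + x *s vec4 0 1 0 y"
        using 1 4 by (intro vec4_eqI) (simp_all add: x_def y_def)
      ultimately show ?thesis
        by (intro gen[of "vec4 1 0 y 0" "vec4 0 1 0 y" 1 2 1 x])
          (simp_all add: vec4_mem_subfield_vecs quad_bilin_hyp_matrix)
    qed
  qed
qed

lemma extended_generators_cover:
  assumes X: "X \<in> hermitian_surface q H \<inter> quadric A"
  shows "\<exists>l\<in>extended_generators S Q'. X \<subseteq> l"
proof -
  from X have "X \<in> pg_points" by (simp add: quadric_def)
  then obtain v where v: "v \<noteq> 0" "X = vec.span {v}" by (auto simp: pg_points_iff)
  obtain s where s: "v = M *v s" by (rule M_surj)
  \<comment> \<open>Scales the first coordinate to 1, and leaves the vector unchanged if that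
    coordinate vanishes.\<close>
  define k where "k = (if s $ 1 = 0 then 1 else 1 / s $ 1)"
  have k: "k \<noteq> 0" by (simp add: k_def)
  have Xk: "X = vec.span {M *v (k *s s)}"
    using v(2) span_singleton_scale[OF k, of v] by (simp add: s vector_scalar_commute)
  have mem: "M *v (k *s s) \<in> X" unfolding Xk by (simp add: vec.span_base)
  have "\<beta> (k *s s) (k *s s) = 0"
    using X mem c_neq_0 by (auto simp: quadric_def quad_bilin_M)
  moreover have "\<beta> (k *s s) (cjv (k *s s)) = 0"
    using X mem unfolding herm_form_M[symmetric] by (auto simp: hermitian_surface_def)
  moreover have "(k *s s) $ 1 = 0 \<or> (k *s s) $ 1 = 1" by (simp add: k_def)
  ultimately have "\<exists>l\<in>extended_generators S Q'. M *v (k *s s) \<in> l"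
    by (intro exists_extended_generator)
  then obtain l where l: "l \<in> extended_generators S Q'" "M *v (k *s s) \<in> l" by (rule bexE)
  then have "vec.subspace l" by (simp add: extended_generators_def pg_lines_def)
  then have "X \<subseteq> l" unfolding Xk using l(2) by (intro vec.span_minimal) auto
  with l(1) show ?thesis by blast
qed

end

section \<open>Passage from the surfaces to their forms and back\<close>

theorem theorem8:
  fixes q :: nat
    and H A :: "'a::{field,finite} ^ 4 ^ 4"
    and P :: "('a ^ 4) set"
  assumes "primepow q" and "odd q" and "CARD('a) = q\<^sup>2"
    and "hermitian_matrix q H" and "det H \<noteq> 0"
    and "transpose A = A" and "irreducible_quadric A"
    and "P \<in> hermitian_surface q H \<inter> quadric A"
    and "nonsingular_point A P"
    and "hermitian_tangent_plane q H P = quadric_tangent_plane A P"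
    and "card (hermitian_surface q H \<inter> quadric A) = 2 * q ^ 3 + q\<^sup>2 + 1"
  shows "hyperbolic_quadric A \<and> permutable_position q H A \<and>
    (\<exists>S Q'. baer_subgeometry q S \<and> baer_quadric q S Q' \<and>
       Q' \<subseteq> hermitian_surface q H \<inter> quadric A \<and>
       (\<forall>X \<in> hermitian_surface q H \<inter> quadric A. \<exists>l \<in> extended_generators S Q'. X \<subseteq> l))"
proof -
  define cj :: "'a \<Rightarrow> 'a" where "cj x = x ^ q" for x
  interpret square_order_field q cj
    by unfold_locales (use assms in \<open>simp_all add: cj_def\<close>)
  let ?h = "herm_form q H" and ?b = "quad_bilin A"
  from assms(8) have "P \<in> pg_points" by (simp add: quadric_def)
  then obtain p where p: "p \<noteq> 0" "P = vec.span {p}" by (auto simp: pg_points_iff)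
  have pP: "p \<in> P" unfolding p(2) by (simp add: vec.span_base)
  have h_scale_left: "?h (c *s x) y = c * ?h x y" for c x y
    by (simp add: herm_form_def sum_distrib_left mult_ac)
  have h_herm: "?h y x = cj (?h x y)" for x y
  proof -
    have Hc: "cj (H $ i $ j) = H $ j $ i" for i j
      using assms(4) unfolding hermitian_matrix_def cj_def by metis
    have "cj (?h x y) = (\<Sum>i\<in>UNIV. \<Sum>j\<in>UNIV. cj (H $ i $ j) * cj (x $ i) * y $ j)"
      by (simp add: herm_form_def cj_sum flip: cj_def)
    also have "\<dots> = (\<Sum>j\<in>UNIV. \<Sum>i\<in>UNIV. H $ j $ i * y $ j * cj (x $ i))"
      by (subst sum.swap) (simp add: Hc mult_ac)
    finally show ?thesis by (simp add: herm_form_def cj_def)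
  qed
  have b_scale_left: "?b (c *s x) y = c * ?b x y" for c x y
    by (simp add: quad_bilin_def sum_distrib_left mult_ac)
  have b_sym: "?b y x = ?b x y" for x y
  proof -
    have sym: "A $ i $ j = A $ j $ i" for i j
      using arg_cong[OF assms(6), of "\<lambda>B. B $ i $ j"] by (simp add: transpose_def)
    show ?thesis
      unfolding quad_bilin_def by (subst sum.swap) (simp add: sym mult_ac)
  qed
  interpret tangent_forms q cj ?h ?b p
  proof unfold_locales
    show "?h (x + y) z = ?h x z + ?h y z" for x y z
      by (simp add: herm_form_def distrib_left distrib_right sum.distrib)
    show "?b (x + y) z = ?b x z + ?b y z" for x y z
      by (simp add: quad_bilin_def distrib_left distrib_right sum.distrib)
    show "x = 0" if h0: "\<And>v. ?h v x = 0" for x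
    proof -
      have h_eq: "?h v x = (\<Sum>i\<in>UNIV. v $ i * (H *v (\<chi> i. cj (x $ i))) $ i)" for v
        by (simp add: herm_form_def matrix_vector_mult_def sum_distrib_left mult_ac cj_def)
      \<comment> \<open>Pairing with unit vectors puts the conjugate of \<open>x\<close> into the
        kernel of the invertible matrix \<open>H\<close>.\<close>
      have "(H *v (\<chi> i. cj (x $ i))) $ k = 0" for k
        using h0[of "axis k 1"] unfolding h_eq by (simp add: axis_def if_distrib if_distribR cong: if_cong)
      then have "H *v (\<chi> i. cj (x $ i)) = 0" by (simp add: vec_eq_iff)
      moreover have "\<exists>B. B ** H = mat 1"
        using assms(5) by (simp add: invertible_det_nz[symmetric] invertible_left_inverse)
      ultimately have "(\<chi> i. cj (x $ i)) = 0"
        unfolding matrix_left_invertible_ker by blast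
      then show "x = 0" by (simp add: vec_eq_iff)
    qed
    show "?h p p = 0" "?b p p = 0"
      using assms(8) pP by (auto simp: hermitian_surface_def quadric_def)
    have hP: "v \<in> hermitian_tangent_plane q H P \<longleftrightarrow> ?h v p = 0" for v
    proof -
      have "?h v (k *s p) = cj k * ?h v p" for k
        using h_scale_left h_herm by (metis cj_mult)
      then show ?thesis
        using pP by (auto simp: hermitian_tangent_plane_def herm_polar_def p(2) vec.span_singleton)
    qed
    have bP: "v \<in> quadric_tangent_plane A P \<longleftrightarrow> ?b v p = 0" for v
      using pP b_sym[of p v]
      by (auto simp: quadric_tangent_plane_def quad_polar_def p(2) vec.span_singleton b_scale_left)
    show "?h v p = 0 \<longleftrightarrow> ?b v p = 0" for v
      using hP bP assms(10) by blast
    let ?V = "{v. ?h v v = 0 \<and> ?b v v = 0}"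
    \<comment> \<open>The common points are those contained in the cone \<open>?V\<close>, which
      converts the given number of points into a number of vectors.\<close>
    have "hermitian_surface q H \<inter> quadric A = {R \<in> pg_points. R \<subseteq> ?V}"
      by (auto simp: hermitian_surface_def quadric_def)
    moreover have "card ?V = (CARD('a) - 1) * card {R \<in> pg_points. R \<subseteq> ?V} + 1"
    proof (rule card_cone_eq_points)
      fix k v assume "v \<in> ?V"
      then show "k *s v \<in> ?V"
        by (simp add: h_scale_left b_scale_left h_herm[of v "k *s v"] b_sym[of v "k *s v"])
    next
      show "0 \<in> ?V"
        using h_scale_left[of 0 0 0] b_scale_left[of 0 0 0] by simp
    qed
    ultimately show "card ?V = (q\<^sup>2 - 1) * (2 * q ^ 3 + q\<^sup>2 + 1) + 1"
      using assms(3,11) by simp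
  qed (fact h_scale_left h_herm b_scale_left b_sym p(1))+
  obtain M c where M: "invertible M" "c \<noteq> 0"
    "\<And>s t. ?h (M *v s) (M *v t) = quad_bilin hyp_matrix s (\<chi> i. cj (t $ i))"
    "\<And>s t. ?b (M *v s) (M *v t) = c * quad_bilin hyp_matrix s t"
    by (rule exists_normal_coordinates) blast
  interpret N: normal_position q cj H A M c
    by unfold_locales (fact M)+
  have "baer_subgeometry q N.S"
    using M(1) by (auto simp: baer_subgeometry_def N.S_def)
  then show ?thesis
    using N.hyperbolic[OF assms(6)] N.permutable N.baer_quadric N.Q'_subset N.extended_generators_cover
    by blast
qed

end
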